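(* Let $\psi$ be a non-increasing continuous positive function such that $\psi(t)<1/t$ for all sufficiently large $t$, and assume moreover that $t\mapsto t\psi(t)$ is non-decreasing. If $\sum_k\left(\frac1k-\psi(k)\right)=\infty$, then $D_2(\psi)$ has Lebesgue measure zero; if $\sum_k\left(\frac1k-\psi(k)\right)<\infty$, then $\mathbb{R}\smallsetminus D_2(\psi)$ has Lebesgue measure zero.
   Context: For a positive function $\psi$, $D_2(\psi)$ is the set of $\alpha\in\mathbb{R}$ such that for all sufficiently large $t>0$ there exist integers $(p,q)\neq(0,0)$ with $\left(\frac{\alpha q-p}{\psi(t)}\right)^2+\left(\frac{q}{t}\right)^2<\frac{2}{\sqrt3}$ (i.e. the lattice $\{(\alpha q-p,q)^T\}$ has a nonzero vector in $\operatorname{diag}(\psi(t),t)B_2(1/\sqrt{\Delta_2})$, with $B_2$ the open Euclidean ball and $\Delta_2=\sqrt3/2$). *)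

theory Defs
  imports "HOL-Analysis.Analysis"
begin

(* Since "eventually" is taken at_top, only the values of \<psi> at large arguments matter. *)
definition D2 :: "(real \<Rightarrow> real) \<Rightarrow> real set" where
  "D2 \<psi> = {\<alpha>. \<forall>\<^sub>F t in at_top. \<exists>p q :: int. (p, q) \<noteq> (0, 0) \<and>
      ((\<alpha> * real_of_int q - real_of_int p) / \<psi> t)\<^sup>2 + (real_of_int q / t)\<^sup>2 < 2 / sqrt 3}"

end

theory Submission
  imports Defs
begin

text \<open>
  Write \<open>z = \<alpha> + i \<psi>(t)/t\<close> and \<open>\<epsilon>(t) = 1 - t \<psi>(t)\<close>. The lattice has no short vector at time \<open>t\<close> iff
  \<open>|qz - p|\<^sup>2 \<ge> (2/\<surd>3) Im z (1 - \<epsilon>(t))\<close> for all \<open>(p, q) \<noteq> (0, 0)\<close>, i.e. iff \<open>z\<close> lies within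
  hyperbolic distance of order \<open>\<epsilon>(t)\<close> of a point \<open>X + iY\<close> in the modular orbit of the hexagonal point
  \<open>\<rho> = e^(i \<pi>/3)\<close>. So the complement of \<open>D\<^sub>2(\<psi>)\<close> is a limsup set of intervals around the numbers \<open>X\<close>,
  of length about \<open>\<epsilon>(1/\<surd>Y) Y\<close>. About \<open>4^n\<close> orbit points per unit interval have \<open>Y\<close> of order
  \<open>4^(-n)\<close>, so by Cauchy condensation the total length converges together with
  \<open>\<Sum>(1/k - \<psi>(k))\<close>.

  In the convergent case the Borel-Cantelli lemma applies. In the divergent case it suffices to use
  one orbit point next to each reduced fraction; reduced fractions are well separated and, by
  Dirichlet's theorem, numerous in every interval, so that the Chung-Erdos inequality shows that
  the limsup set fills a fixed proportion of every interval and hence has full measure.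
\<close>

section \<open>Two measure-theoretic tools\<close>

text \<open>A weak form of the Lebesgue density theorem. Inside an open \<open>T\<close> around
  \<open>F\<close> of excess below \<open>e\<close>, the Vitali covering theorem fills almost all of
  \<open>F\<close> with disjoint balls in which \<open>F\<close> has proportion at most
  \<open>\<theta>\<close>. Hence \<open>|F| \<le> \<theta> (|F| + e)\<close> for every
  \<open>e > 0\<close>, which forces \<open>|F| = 0\<close>.\<close>

lemma negligible_if_density_le_bounded:
  fixes F :: "'a::euclidean_space set"
  assumes F: "F \<in> lmeasurable" and \<theta>: "0 \<le> \<theta>" "\<theta> < 1"
    and dens: "\<And>x d. x \<in> F \<Longrightarrow> d > 0 \<Longrightarrow> \<exists>r. 0 < r \<and> r < d \<and>
      emeasure lebesgue (F \<inter> ball x r) \<le> ennreal \<theta> * emeasure lebesgue (ball x r)"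
  shows "negligible F"
proof -
  have bound: "measure lebesgue F \<le> \<theta> * (measure lebesgue F + e)" if e: "e > 0" for e
  proof -
    obtain T where T: "open T" "F \<subseteq> T" "T - F \<in> lmeasurable" "emeasure lebesgue (T - F) < ennreal e"
      using sets_lebesgue_outer_open[OF fmeasurableD[OF F] e] by blast
    define K where "K = {(x, r). x \<in> F \<and> 0 < r \<and> ball x r \<subseteq> T \<and>
      emeasure lebesgue (F \<inter> ball x r) \<le> ennreal \<theta> * emeasure lebesgue (ball x r)}"
    have cov: "\<exists>i. i \<in> K \<and> x \<in> ball (fst i) (snd i) \<and> snd i < d" if "x \<in> F" "0 < d" for x d
    proof -
      obtain k where k: "k > 0" "ball x k \<subseteq> T"
        using T(1,2) \<open>x \<in> F\<close> by (meson openE subsetD)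
      obtain r where r: "0 < r" "r < min d k"
        "emeasure lebesgue (F \<inter> ball x r) \<le> ennreal \<theta> * emeasure lebesgue (ball x r)"
        using dens[OF \<open>x \<in> F\<close>, of "min d k"] k \<open>0 < d\<close> by auto
      have "ball x r \<subseteq> T"
        using r(2) k(2) by (meson dual_order.trans less_imp_le min_less_iff_conj subset_ball)
      with r that show ?thesis
        by (intro exI[of _ "(x, r)"]) (auto simp: K_def)
    qed
    obtain C where C: "countable C" "C \<subseteq> K"
      "pairwise (\<lambda>i j. disjnt (ball (fst i) (snd i)) (ball (fst j) (snd j))) C"
      "negligible (F - (\<Union>i \<in> C. ball (fst i) (snd i)))"
      by (rule Vitali_covering_theorem_balls[OF cov])
    let ?B = "\<lambda>i. ball (fst i) (snd i)"
    have disj: "disjoint_family_on ?B C" "disjoint_family_on (\<lambda>i. F \<inter> ?B i) C"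
      using C(3) by (fastforce simp: disjoint_family_on_def pairwise_def disjnt_def)+
    have meas: "F \<inter> ?B i \<in> sets lebesgue" for i
      using F by (intro sets.Int) auto
    have "emeasure lebesgue F = emeasure lebesgue (F \<inter> (\<Union>i\<in>C. ?B i))"
    proof (rule emeasure_eq_AE)
      have "AE x in lebesgue. x \<notin> F - (\<Union>i\<in>C. ?B i)"
        using C(4) by (intro AE_not_in) (simp add: negligible_iff_null_sets)
      then show "AE x in lebesgue. (x \<in> F) = (x \<in> F \<inter> (\<Union>i\<in>C. ?B i))"
        by eventually_elim auto
      show "F \<inter> (\<Union>i\<in>C. ?B i) \<in> sets lebesgue"
        by (intro sets.Int fmeasurableD[OF F] sets_completionI_sets) (simp add: borel_open open_UN)
    qed (use F in auto)
    also have "F \<inter> (\<Union>i\<in>C. ?B i) = (\<Union>i\<in>C. F \<inter> ?B i)" by auto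
    also have "emeasure lebesgue \<dots> = (\<integral>\<^sup>+i. emeasure lebesgue (F \<inter> ?B i) \<partial>count_space C)"
      using C(1) disj(2) meas by (intro emeasure_UN_countable) auto
    also have "\<dots> \<le> (\<integral>\<^sup>+i. ennreal \<theta> * emeasure lebesgue (?B i) \<partial>count_space C)"
      using C(2) by (intro nn_integral_mono) (auto simp: K_def)
    also have "\<dots> = ennreal \<theta> * (\<integral>\<^sup>+i. emeasure lebesgue (?B i) \<partial>count_space C)"
      by (intro nn_integral_cmult) auto
    also have "(\<integral>\<^sup>+i. emeasure lebesgue (?B i) \<partial>count_space C) = emeasure lebesgue (\<Union>i\<in>C. ?B i)"
      using C(1) disj(1) by (intro emeasure_UN_countable[symmetric]) auto
    also have "ennreal \<theta> * emeasure lebesgue (\<Union>i\<in>C. ?B i) \<le> ennreal \<theta> * emeasure lebesgue (F \<union> (T - F))"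
    proof (intro mult_left_mono emeasure_mono sets.Un fmeasurableD[OF F] fmeasurableD[OF T(3)])
      show "(\<Union>i\<in>C. ?B i) \<subseteq> F \<union> (T - F)"
        using C(2) by (fastforce simp: K_def)
    qed simp
    also have "emeasure lebesgue (F \<union> (T - F)) \<le> emeasure lebesgue F + emeasure lebesgue (T - F)"
      by (intro emeasure_subadditive fmeasurableD[OF F] fmeasurableD[OF T(3)])
    also have "\<dots> \<le> ennreal (measure lebesgue F + e)"
      using T(4) F e by (subst ennreal_plus)
        (auto simp: emeasure_eq_measure2 intro!: add_left_mono less_imp_le)
    finally have "emeasure lebesgue F \<le> ennreal \<theta> * ennreal (measure lebesgue F + e)"
      by (simp add: mult_left_mono)
    then have "ennreal (measure lebesgue F) \<le> ennreal (\<theta> * (measure lebesgue F + e))"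
      using F e \<theta> by (simp add: emeasure_eq_measure2 ennreal_mult)
    then show ?thesis using e \<theta> by (simp add: ennreal_le_iff)
  qed
  have "measure lebesgue F = 0"
  proof (rule ccontr)
    assume "measure lebesgue F \<noteq> 0"
    then have m: "measure lebesgue F > 0" by (simp add: zero_less_measure_iff)
    define e where "e = (1 - \<theta>) * measure lebesgue F / 2"
    have "e > 0" unfolding e_def using m \<theta> by simp
    from bound[OF this] have "measure lebesgue F * (1 - \<theta>) \<le> \<theta> * e" by (simp add: algebra_simps)
    also have "\<dots> \<le> e" using \<theta> \<open>e > 0\<close> by simp
    also have "\<dots> < measure lebesgue F * (1 - \<theta>)" unfolding e_def using m \<theta> by simp
    finally show False by simp
  qed
  then show ?thesis
    using F negligible_iff_measure0 by blast
qed

lemma negligible_if_density_le: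
  fixes F :: "'a::euclidean_space set"
  assumes F: "F \<in> sets lebesgue" and \<theta>: "0 \<le> \<theta>" "\<theta> < 1"
    and dens: "\<And>x d. x \<in> F \<Longrightarrow> d > 0 \<Longrightarrow> \<exists>r. 0 < r \<and> r < d \<and>
      emeasure lebesgue (F \<inter> ball x r) \<le> ennreal \<theta> * emeasure lebesgue (ball x r)"
  shows "negligible F"
proof -
  have "negligible (F \<inter> ball 0 (real n))" for n
  proof (rule negligible_if_density_le_bounded[OF _ \<theta>])
    show "F \<inter> ball 0 (real n) \<in> lmeasurable"
      using F by (intro bounded_set_imp_lmeasurable) (auto simp: bounded_Int)
    fix x :: 'a and d :: real assume "x \<in> F \<inter> ball 0 (real n)" "d > 0"
    then obtain r where r: "0 < r" "r < d"
      "emeasure lebesgue (F \<inter> ball x r) \<le> ennreal \<theta> * emeasure lebesgue (ball x r)"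
      using dens by blast
    have "emeasure lebesgue (F \<inter> ball 0 (real n) \<inter> ball x r) \<le> emeasure lebesgue (F \<inter> ball x r)"
      using F by (intro emeasure_mono) auto
    with r show "\<exists>r. 0 < r \<and> r < d \<and>
      emeasure lebesgue (F \<inter> ball 0 (real n) \<inter> ball x r) \<le> ennreal \<theta> * emeasure lebesgue (ball x r)"
      by (meson order_trans)
  qed
  then have "negligible (\<Union>n. F \<inter> ball 0 (real n))"
    by (intro negligible_countable_Union) auto
  also have "(\<Union>n. F \<inter> ball 0 (real n)) = F"
    using real_arch_simple by (auto simp: reals_Archimedean2)
  finally show ?thesis .
qed

text \<open>Cauchy-Schwarz for the counting function of the \<open>B j\<close> on their union
  \<open>U\<close>, obtained from the nonnegativity of the integral of its squared difference from
  \<open>l\<close> times the indicator of \<open>U\<close>, a quadratic polynomial in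
  \<open>l\<close>.\<close>

lemma Chung_Erdos_inequality:
  assumes J: "finite J" and B: "\<And>j. j \<in> J \<Longrightarrow> B j \<in> fmeasurable M"
  shows "(\<Sum>j\<in>J. measure M (B j))\<^sup>2 \<le>
    measure M (\<Union>j\<in>J. B j) * (\<Sum>i\<in>J. \<Sum>j\<in>J. measure M (B i \<inter> B j))"
proof -
  define U where "U = (\<Union>j\<in>J. B j)"
  define S where "S = (\<Sum>j\<in>J. measure M (B j))"
  define D where "D = (\<Sum>i\<in>J. \<Sum>j\<in>J. measure M (B i \<inter> B j))"
  have U: "U \<in> fmeasurable M" unfolding U_def using J B by (intro fmeasurable.finite_UN) auto
  have BB: "B i \<inter> B j \<in> fmeasurable M" if "i \<in> J" "j \<in> J" for i j
    using B that by (intro fmeasurable.Int) auto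
  have quad: "0 \<le> D - 2 * l * S + l\<^sup>2 * measure M U" for l :: real
  proof -
    have eq: "((\<Sum>j\<in>J. indicator (B j) x) - l * indicator U x)\<^sup>2 =
       (\<Sum>i\<in>J. \<Sum>j\<in>J. indicator (B i \<inter> B j) x) - 2 * l * (\<Sum>j\<in>J. indicator (B j) x) +
       l\<^sup>2 * indicator U x" for x
    proof (cases "x \<in> U")
      case True
      then show ?thesis
        by (simp add: power2_eq_square algebra_simps sum_product indicator_inter_arith)
    next
      case False
      then have "indicator (B j) x = (0::real)" if "j \<in> J" for j using that by (auto simp: U_def)
      then show ?thesis using False by (simp add: indicator_inter_arith)
    qed
    have "0 \<le> (\<integral>x. ((\<Sum>j\<in>J. indicator (B j) x) - l * indicator U x)\<^sup>2 \<partial>M)"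
      by (intro integral_nonneg_AE) auto
    also have "\<dots> = (\<integral>x. (\<Sum>i\<in>J. \<Sum>j\<in>J. indicator (B i \<inter> B j) x) - 2 * l * (\<Sum>j\<in>J. indicator (B j) x) +
       l\<^sup>2 * indicator U x \<partial>M)" by (simp only: eq)
    also have "\<dots> = D - 2 * l * S + l\<^sup>2 * measure M U"
    proof -
      have ind: "has_bochner_integral M (indicator A) (measure M A)" if "A \<in> fmeasurable M" for A
        using that by (intro has_bochner_integral_real_indicator) (auto simp: fmeasurable_def)
      show ?thesis unfolding D_def S_def
        by (intro has_bochner_integral_integral_eq has_bochner_integral_add has_bochner_integral_diff
            has_bochner_integral_sum has_bochner_integral_mult_right ind B BB U)
    qed
    finally show ?thesis .
  qed
  show ?thesis
  proof (cases "measure M U = 0")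
    case True
    have "measure M (B j) = 0" if "j \<in> J" for j
    proof -
      have "measure M (B j) \<le> measure M U"
        using that B U by (intro measure_mono_fmeasurable) (auto simp: U_def)
      then show ?thesis using True by (simp add: measure_le_0_iff)
    qed
    then show ?thesis by (simp add: sum_nonneg)
  next
    case False
    then have m: "measure M U > 0" by (simp add: zero_less_measure_iff)
    \<comment> \<open>The quadratic in \<open>l\<close> is smallest at
      \<open>l = S / |U|\<close>.\<close>
    have "0 \<le> D - S\<^sup>2 / measure M U"
      using quad[of "S / measure M U"] m by (simp add: power2_eq_square field_simps)
    then have "S\<^sup>2 \<le> measure M U * D" using m by (simp add: field_simps)
    then show ?thesis by (simp add: U_def S_def D_def)
  qed
qed

section \<open>Hexagonal points near reduced fractions\<close>

text \<open>The norm form of the Eisenstein integers is positive definite with integer values. It is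
  the squared length of \<open>m \<rho> + n\<close> for
  \<open>\<rho> = e^(i \<pi>/3)\<close>.\<close>

lemma eisenstein_form_pos:
  fixes m n :: int
  assumes "(m, n) \<noteq> (0, 0)"
  shows "m\<^sup>2 + m * n + n\<^sup>2 \<ge> 1"
proof -
  have "0 < m\<^sup>2 + n\<^sup>2" using assms by (simp add: sum_power2_gt_zero_iff)
  moreover have "2 * (m\<^sup>2 + m * n + n\<^sup>2) = (m + n)\<^sup>2 + (m\<^sup>2 + n\<^sup>2)"
    by (simp add: power2_eq_square algebra_simps)
  ultimately have "0 < 2 * (m\<^sup>2 + m * n + n\<^sup>2)" by (smt (verit) zero_le_power2)
  then have "0 < m\<^sup>2 + m * n + n\<^sup>2" by (simp only: zero_less_mult_iff) simp
  then show ?thesis by linarith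
qed

text \<open>The point \<open>x + iY\<close> is the image
  \<open>(p \<rho> + b) / (q \<rho> + d)\<close> of \<open>\<rho> = e^(i \<pi>/3)\<close> under an
  integer matrix of determinant 1 with first column \<open>(p, q)\<close>. Its lattice is a rotated
  and scaled hexagonal lattice, whose nonzero vectors have squared length at least
  \<open>1/Q = (2/sqrt 3) Y\<close>.\<close>

lemma hexagonal_point_near_fraction:
  fixes p q :: int
  assumes cop: "coprime p q" and q: "q > 0"
  shows "\<exists>(x :: real) (Y :: real). \<bar>x - p / q\<bar> \<le> 1 / q\<^sup>2 \<and> 1 / (4 * q\<^sup>2) \<le> Y \<and> Y \<le> 1 / q\<^sup>2 \<and>
    (\<forall>(p' :: int) (q' :: int). p' \<noteq> 0 \<or> q' \<noteq> 0 \<longrightarrow> (real_of_int q' * x - real_of_int p')\<^sup>2 + (real_of_int q' * Y)\<^sup>2 \<ge> 2 / sqrt 3 * Y)"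
proof -
  obtain u v where uv: "u * p + v * q = 1"
    using bezout_int[of p q] cop by (auto simp: coprime_iff_gcd_eq_1)
  \<comment> \<open>The condition \<open>0 \<le> d < q\<close> keeps \<open>Q\<close> between
    \<open>q^2\<close> and \<open>3 q^2\<close>, so the height \<open>Y\<close> is comparable to
    \<open>1/q^2\<close>.\<close>
  define d where "d = u mod q"
  define b where "b = - v - p * (u div q)"
  have d: "0 \<le> d" "d < q" using q by (auto simp: d_def)
  have b: "p * d - 1 = q * b"
    using uv div_mult_mod_eq[of u q] unfolding d_def b_def by algebra
  \<comment> \<open>\<open>Q\<close> is \<open>|q \<rho> + d|^2\<close>, and \<open>N\<close> is the
    real part of \<open>p \<rho> + b\<close> times the conjugate of \<open>q \<rho> + d\<close>. The
    imaginary part of that product is \<open>sqrt 3 / 2\<close>, by the determinant.\<close>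
  define Q where "Q = q\<^sup>2 + q * d + d\<^sup>2"
  define N :: real where "N = p * q + (p * d + b * q) / 2 + b * d"
  have det: "real_of_int p * real_of_int d - real_of_int b * real_of_int q = 1"
    using arg_cong[OF b, of real_of_int] by (simp add: algebra_simps)
  have Q: "q\<^sup>2 \<le> Q" "Q \<le> 3 * q\<^sup>2"
  proof -
    have "q * d \<le> q * q" "d * d \<le> q * q" "0 \<le> q * d" using d by (auto intro!: mult_mono)
    then show "q\<^sup>2 \<le> Q" "Q \<le> 3 * q\<^sup>2" by (auto simp: Q_def power2_eq_square)
  qed
  have q2: "0 < real_of_int q ^ 2" using q by simp
  have RQ: "real_of_int q ^ 2 \<le> Q" "Q \<le> 3 * real_of_int q ^ 2"
    using Q by (metis of_int_le_iff of_int_power, metis of_int_le_iff of_int_mult of_int_numeral of_int_power)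
  have Qpos: "real_of_int Q > 0" using RQ(1) q2 by linarith
  define x where "x = N / Q"
  define Y where "Y = sqrt 3 / 2 / Q"
  have s3: "sqrt 3 * sqrt 3 = (3::real)" "17 / 10 \<le> sqrt (3::real)" "sqrt (3::real) \<le> 18 / 10"
    by (simp, rule real_le_rsqrt, simp add: power2_eq_square, rule real_le_lsqrt, auto simp: power2_eq_square)
  have Qr: "real_of_int Q = q\<^sup>2 + q * d + d\<^sup>2" by (simp add: Q_def)
  define P where "P = real_of_int p ^ 2 + real_of_int p * real_of_int b + real_of_int b ^ 2"
  \<comment> \<open>Multiplicativity of the norm: \<open>P\<close> is
    \<open>|p \<rho> + b|^2\<close>, and both sides are the squared modulus of the product whose
    real part is \<open>N\<close>.\<close>
  have "N\<^sup>2 + 3 / 4 * (real_of_int p * real_of_int d - real_of_int b * real_of_int q)\<^sup>2 = Q * P"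
    unfolding N_def P_def by (simp add: Qr power2_eq_square field_simps)
  then have NP: "N\<^sup>2 + 3 / 4 = Q * P" by (simp only: det) simp
  have "\<bar>x - p / q\<bar> \<le> 1 / q\<^sup>2"
  proof -
    have "x - p / q = (N * q - p * Q) / (Q * q)"
      using Qpos q by (simp add: x_def field_simps)
    also have "N * q - p * Q = - (q / 2 + d) * (real_of_int p * real_of_int d - real_of_int b * real_of_int q)"
      unfolding N_def by (simp add: Qr power2_eq_square field_simps)
    also have "\<dots> = - (q / 2 + d)" by (simp only: det mult_1_right)
    finally have e: "\<bar>x - p / q\<bar> = (q / 2 + d) / (Q * q)"
      using Qpos q d by (simp add: abs_divide abs_mult)
    have "(q / 2 + d) * q \<le> Q"
      using d q unfolding Qr by (simp add: power2_eq_square algebra_simps)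
    then have "(q / 2 + d) * q * q \<le> real_of_int Q * real_of_int q" using q by (intro mult_right_mono) auto
    then show ?thesis unfolding e using Qpos q by (simp add: field_simps power2_eq_square)
  qed
  moreover have "1 / (4 * q\<^sup>2) \<le> Y"
  proof -
    have "1 / (4 * q\<^sup>2) \<le> sqrt 3 / 2 / (3 * q\<^sup>2)"
      using q2 s3 by (simp add: field_simps)
    also have "\<dots> \<le> Y" unfolding Y_def using RQ q2 Qpos q by (intro divide_left_mono) auto
    finally show ?thesis .
  qed
  moreover have "Y \<le> 1 / q\<^sup>2"
    unfolding Y_def using RQ q2 s3 Qpos by (intro frac_le) auto
  moreover have "\<forall>(p' :: int) (q' :: int). p' \<noteq> 0 \<or> q' \<noteq> 0 \<longrightarrow> (real_of_int q' * x - real_of_int p')\<^sup>2 + (real_of_int q' * Y)\<^sup>2 \<ge> 2 / sqrt 3 * Y"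
  proof (intro allI impI)
    fix p' q' :: int assume that: "p' \<noteq> 0 \<or> q' \<noteq> 0"
    \<comment> \<open>For \<open>z = x + iY\<close> one has
      \<open>q' z - p' = (m \<rho> + n) / (q \<rho> + d)\<close>, so the form takes the value
      \<open>(m^2 + m n + n^2) / Q\<close>.\<close>
    define m where "m = q' * p - p' * q"
    define n where "n = q' * b - p' * d"
    have "(m, n) \<noteq> (0, 0)"
    proof
      assume "(m, n) = (0, 0)"
      then have "m = 0" "n = 0" by auto
      moreover have "m * d - n * q = q' * (p * d - q * b)" "m * b - n * p = p' * (p * d - q * b)"
        unfolding m_def n_def by (simp_all add: algebra_simps)
      moreover have "p * d - q * b = 1" using b by simp
      ultimately show False using that by simp
    qed
    from eisenstein_form_pos[OF this] have mn: "real_of_int (m\<^sup>2 + m * n + n\<^sup>2) \<ge> 1" by linarith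
    have "Q * Q * ((q' * x - p')\<^sup>2 + (q' * Y)\<^sup>2) = (q' * N - p' * Q)\<^sup>2 + 3 / 4 * q'\<^sup>2"
      using Qpos s3(1) unfolding x_def Y_def by (simp add: field_simps power2_eq_square)
    also have "\<dots> = q'\<^sup>2 * (N\<^sup>2 + 3 / 4) - 2 * q' * p' * N * Q + p'\<^sup>2 * Q * Q"
      by (simp add: power2_eq_square algebra_simps)
    also have "\<dots> = Q * (q'\<^sup>2 * P - 2 * q' * p' * N + p'\<^sup>2 * Q)"
      unfolding NP by (simp add: algebra_simps)
    also have "q'\<^sup>2 * P - 2 * q' * p' * N + p'\<^sup>2 * Q = m\<^sup>2 + m * n + n\<^sup>2"
      unfolding m_def n_def N_def P_def by (simp add: Qr power2_eq_square algebra_simps)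
    also have "Q * real_of_int (m\<^sup>2 + m * n + n\<^sup>2) \<ge> real_of_int Q * 1" using mn Qpos by (intro mult_left_mono) auto
    finally have "Q * (Q * ((q' * x - p')\<^sup>2 + (q' * Y)\<^sup>2)) \<ge> real_of_int Q * 1" by (simp add: mult.assoc)
    then have "Q * ((q' * x - p')\<^sup>2 + (q' * Y)\<^sup>2) \<ge> 1" using Qpos by simp
    then have "(q' * x - p')\<^sup>2 + (q' * Y)\<^sup>2 \<ge> 1 / Q" using Qpos by (simp add: field_simps)
    also have "1 / Q = 2 / sqrt 3 * Y" unfolding Y_def by simp
    finally show "(real_of_int q' * x - real_of_int p')\<^sup>2 + (real_of_int q' * Y)\<^sup>2 \<ge> 2 / sqrt 3 * Y" .
  qed
  ultimately show ?thesis by (intro exI[of _ x] exI[of _ Y] conjI)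
qed

text \<open>A horizontal shift of \<open>x + iY\<close> shears the lattice. The only new term that
  may be negative is the cross term \<open>2 l u w\<close>, and
  \<open>2 |u w| \<le> u^2 + w^2\<close> bounds it by \<open>e\<close> times the unshifted
  form.\<close>

lemma form_shift_ge:
  fixes q p x \<alpha> Y :: real
  assumes Y: "Y > 0" and f: "(q * x - p)\<^sup>2 + (q * Y)\<^sup>2 \<ge> c"
    and \<delta>: "\<bar>\<alpha> - x\<bar> \<le> e * Y" and e: "0 \<le> e" "e < 1"
  shows "(\<alpha> * q - p)\<^sup>2 + (q * Y)\<^sup>2 \<ge> c * (1 - e)"
proof -
  define u where "u = q * x - p"
  define w where "w = q * Y"
  define l where "l = (\<alpha> - x) / Y"
  have l: "\<bar>l\<bar> \<le> e" using \<delta> Y by (simp add: l_def abs_divide field_simps)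
  have eq: "\<alpha> * q - p = u + l * w" using Y by (simp add: u_def w_def l_def field_simps)
  have "2 * \<bar>u * w\<bar> \<le> u\<^sup>2 + w\<^sup>2"
    using zero_le_power2[of "\<bar>u\<bar> - \<bar>w\<bar>"] by (simp add: power2_eq_square algebra_simps abs_mult)
  moreover have "\<bar>2 * l * (u * w)\<bar> \<le> 2 * e * \<bar>u * w\<bar>"
    using l by (simp add: abs_mult mult_mono)
  moreover have "e * (2 * \<bar>u * w\<bar>) \<le> e * (u\<^sup>2 + w\<^sup>2)"
    using calculation(1) e by (intro mult_left_mono) auto
  ultimately have "\<bar>2 * l * (u * w)\<bar> \<le> e * (u\<^sup>2 + w\<^sup>2)" by (simp add: algebra_simps)
  then have "(u\<^sup>2 + w\<^sup>2) * (1 - e) \<le> u\<^sup>2 + w\<^sup>2 + 2 * l * (u * w)" by (simp add: algebra_simps)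
  also have "\<dots> \<le> u\<^sup>2 + w\<^sup>2 + 2 * l * (u * w) + (l * w)\<^sup>2" by simp
  also have "\<dots> = (\<alpha> * q - p)\<^sup>2 + (q * Y)\<^sup>2" unfolding eq w_def[symmetric]
    by (simp add: power2_eq_square algebra_simps)
  finally have "(u\<^sup>2 + w\<^sup>2) * (1 - e) \<le> (\<alpha> * q - p)\<^sup>2 + (q * Y)\<^sup>2" .
  moreover have "c * (1 - e) \<le> (u\<^sup>2 + w\<^sup>2) * (1 - e)"
    using f e by (intro mult_right_mono) (auto simp: u_def w_def)
  ultimately show ?thesis by linarith
qed

section \<open>Spacing of reduced fractions and upper bounds for their number\<close>

text \<open>Coprimality and positive denominators make distinct pairs distinct fractions, which then
  differ by a nonzero integer over \<open>q q' < L^2\<close>.\<close>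

lemma coprime_fractions_separated:
  fixes p q p' q' :: int
  assumes "coprime p q" "coprime p' q'" "0 < q" "0 < q'" "real_of_int q < L" "real_of_int q' < L"
    and ne: "(p, q) \<noteq> (p', q')"
  shows "\<bar>p / q - p' / q'\<bar> > 1 / L\<^sup>2"
proof -
  have "p * q' \<noteq> p' * q"
  proof
    assume "p * q' = p' * q"
    then have "\<bar>p\<bar> * \<bar>q'\<bar> = \<bar>p'\<bar> * \<bar>q\<bar>" by (simp flip: abs_mult)
    then have "\<bar>p\<bar> = \<bar>p'\<bar> \<and> \<bar>q'\<bar> = \<bar>q\<bar>"
      using coprime_crossproduct_int[of p q p' q'] assms by blast
    with assms \<open>p * q' = p' * q\<close> show False by auto
  qed
  then have "1 \<le> \<bar>p * q' - p' * q\<bar>" by linarith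
  then have "1 \<le> \<bar>real_of_int p * q' - p' * q\<bar>"
    by (metis of_int_1_le_iff of_int_abs of_int_diff of_int_mult)
  moreover have "p / q - p' / q' = (real_of_int p * q' - p' * q) / (q * q')"
    using assms by (simp add: field_simps)
  ultimately have "\<bar>p / q - p' / q'\<bar> \<ge> 1 / (real_of_int q * q')"
    using assms by (simp add: abs_mult divide_right_mono)
  moreover have "real_of_int q * q' < L * L" using assms by (intro mult_strict_mono) auto
  then have "1 / (L * L) < 1 / (real_of_int q * q')"
    using assms by (intro divide_strict_left_mono) auto
  ultimately show ?thesis by (simp add: power2_eq_square)
qed

text \<open>As the fractions are more than \<open>1/L^2\<close> apart, the floor of
  \<open>L^2 (p/q - \<xi>)\<close> is injective on them, and it takes at most
  \<open>2 R L^2 + 2\<close> values.\<close>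

lemma card_coprime_fractions_le:
  fixes \<xi> R L :: real
  assumes L: "L > 0" and R: "R \<ge> 0"
  defines "S \<equiv> {(p :: int, q :: int). coprime p q \<and> 0 < q \<and> q < L \<and> \<bar>p / q - \<xi>\<bar> \<le> R}"
  shows "finite S" "real (card S) \<le> 2 * R * L\<^sup>2 + 2"
proof -
  define g where "g = (\<lambda>(p :: int, q :: int). \<lfloor>L\<^sup>2 * (p / q - \<xi>)\<rfloor>)"
  have inj: "inj_on g S"
  proof (rule inj_onI, rule ccontr)
    fix v w assume v: "v \<in> S" "w \<in> S" and g: "g v = g w" and ne: "v \<noteq> w"
    obtain p q p' q' where vw: "v = (p, q)" "w = (p', q')" by (cases v, cases w)
    have "\<bar>p / q - p' / q'\<bar> > 1 / L\<^sup>2"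
      using v ne unfolding S_def vw by (intro coprime_fractions_separated) auto
    then have "L\<^sup>2 * \<bar>p / q - p' / q'\<bar> > 1" using L by (simp add: field_simps)
    then have "\<bar>L\<^sup>2 * (p / q - \<xi>) - L\<^sup>2 * (p' / q' - \<xi>)\<bar> > 1"
      by (simp add: right_diff_distrib[symmetric] abs_mult)
    moreover have "\<bar>L\<^sup>2 * (p / q - \<xi>) - L\<^sup>2 * (p' / q' - \<xi>)\<bar> < 1"
      using g unfolding g_def vw by simp linarith
    ultimately show False by simp
  qed
  have sub: "g ` S \<subseteq> {\<lfloor>- (R * L\<^sup>2)\<rfloor>..\<lfloor>R * L\<^sup>2\<rfloor>}"
  proof (clarsimp simp: S_def g_def, intro conjI floor_mono)
    fix p q :: int assume "\<bar>p / q - \<xi>\<bar> \<le> R"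
    then have "L\<^sup>2 * \<bar>p / q - \<xi>\<bar> \<le> L\<^sup>2 * R" by (intro mult_left_mono) auto
    then have "\<bar>L\<^sup>2 * (p / q - \<xi>)\<bar> \<le> R * L\<^sup>2" by (simp add: abs_mult mult.commute)
    then show "- (R * L\<^sup>2) \<le> L\<^sup>2 * (p / q - \<xi>)" "L\<^sup>2 * (p / q - \<xi>) \<le> R * L\<^sup>2" by auto
  qed
  show "finite S" using inj sub by (metis finite_atLeastAtMost_int finite_imageD finite_subset)
  have "card S = card (g ` S)" using inj by (simp add: card_image)
  also have "\<dots> \<le> card {\<lfloor>- (R * L\<^sup>2)\<rfloor>..\<lfloor>R * L\<^sup>2\<rfloor>}" using sub by (intro card_mono) auto
  finally have "card S \<le> nat (\<lfloor>R * L\<^sup>2\<rfloor> - \<lfloor>- (R * L\<^sup>2)\<rfloor> + 1)" by simp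
  moreover have "R * L\<^sup>2 \<ge> 0" using R by simp
  ultimately show "real (card S) \<le> 2 * R * L\<^sup>2 + 2"
    by linarith
qed

section \<open>Reduced fractions in an interval\<close>

text \<open>Each dyadic block contributes at most 1. Divided by a quantity of order
  \<open>2^n\<close>, this bound tends to zero, which disposes of the boundary terms in the count of
  numerators below.\<close>

lemma sum_inverse_less_power2:
  "(\<Sum>q\<in>{1..<2^n}. 1 / real q) \<le> real n"
proof (induction n)
  case (Suc n)
  have "{1..<2 ^ Suc n} = {1..<2 ^ n} \<union> {2 ^ n..<2 ^ Suc n::nat}"
    by (subst ivl_disj_un_two(3)) auto
  then have "(\<Sum>q\<in>{1..<2 ^ Suc n}. 1 / real q) =
      (\<Sum>q\<in>{1..<2 ^ n}. 1 / real q) + (\<Sum>q\<in>{2 ^ n..<2 ^ Suc n}. 1 / real q)"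
    by (simp only:) (rule sum.union_disjoint, auto)
  also have "(\<Sum>q\<in>{2 ^ n..<2 ^ Suc n}. 1 / real q) \<le> (\<Sum>q\<in>{2 ^ n..<2 ^ Suc n::nat}. 1 / 2 ^ n)"
  proof (intro sum_mono divide_left_mono)
    fix q :: nat assume "q \<in> {2 ^ n..<2 ^ Suc n}"
    then have "2 ^ n \<le> q" by simp
    then have "real (2 ^ n) \<le> real q" by (simp only: of_nat_le_iff)
    then show "2 ^ n \<le> real q" by simp
    then show "0 < real q * 2 ^ n" by (smt (verit) mult_pos_pos zero_less_power)
  qed auto
  also have "\<dots> = 1" by simp
  finally show ?case using Suc by simp
qed simp

lemma measure_UN_ball_le:
  fixes x r :: "'i \<Rightarrow> real"
  assumes "finite J" "\<And>j. j \<in> J \<Longrightarrow> 0 \<le> r j"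
  shows "measure lebesgue (\<Union>j\<in>J. ball (x j) (r j)) \<le> (\<Sum>j\<in>J. 2 * r j)"
proof -
  have "measure lebesgue (\<Union>j\<in>J. ball (x j) (r j)) \<le> (\<Sum>j\<in>J. measure lebesgue (ball (x j) (r j)))"
    using assms by (intro measure_UNION_le) auto
  also have "\<dots> = (\<Sum>j\<in>J. 2 * r j)"
    using assms by (intro sum.cong) (auto simp: ball_eq_greaterThanLessThan)
  finally show ?thesis .
qed

text \<open>By Dirichlet's theorem the balls \<open>B(p/q, 1/(qN))\<close> with \<open>q \<le> N = 8 * 2^n\<close> cover the interval,
  while those with \<open>q < 2^n\<close> only cover about a quarter of it.\<close>
lemma card_coprime_fractions_ge:
  fixes \<xi> h :: real
  assumes h: "h > 0"
  defines "G \<equiv> \<lambda>n. {(p :: int, q :: int). coprime p q \<and> 2 ^ n \<le> q \<and> q \<le> 8 * 2 ^ n \<and> \<bar>p / q - \<xi>\<bar> \<le> 2 * h}"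
  shows "\<forall>\<^sub>F n in sequentially. 4 * h * 4 ^ n \<le> real (card (G n))"
proof -
  have "(\<lambda>n. real n * (1/2) ^ n) \<longlonglongrightarrow> 0" "(\<lambda>n. (1/2::real) ^ n) \<longlonglongrightarrow> 0"
    by (auto intro!: powser_times_n_limit_0 LIMSEQ_power_zero)
  then have "\<forall>\<^sub>F n in sequentially. real n * (1/2) ^ n < h / 2" "\<forall>\<^sub>F n in sequentially. (1/2) ^ n < h"
    using h order_tendstoD(2)[of _ 0 sequentially "h / 2"] order_tendstoD(2)[of _ 0 sequentially h] by auto
  then show ?thesis
  proof eventually_elim
    case (elim n)
    define N :: nat where "N = 8 * 2 ^ n"
    have N: "N > 0" by (simp add: N_def)
    have N': "real N = 8 * 2 ^ n" by (simp add: N_def)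
    define c r where "c = (\<lambda>(p :: int, q :: int). real_of_int p / q)"
      and "r = (\<lambda>(p :: int, q :: int). 1 / (real_of_int q * N))"
    \<comment> \<open>An overcount of the fractions with \<open>q < 2^n\<close> whose ball can meet
      the interval: coprimality is dropped, so that for each \<open>q\<close> the numerators form an
      interval of integers.\<close>
    define bad :: "(int \<times> int) set" where
      "bad = (\<lambda>(q, p). (p, int q)) ` (SIGMA q:{1..<2 ^ n}. {\<lceil>q * \<xi> - q * h - 1\<rceil>..\<lfloor>q * \<xi> + q * h + 1\<rfloor>})"
    have fG: "finite (G n)"
    proof (rule finite_subset)
      show "G n \<subseteq> {(p, q). coprime p q \<and> 0 < q \<and> real_of_int q < 9 * 2 ^ n \<and> \<bar>p / q - \<xi>\<bar> \<le> 2 * h}"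
      proof (clarsimp simp: G_def)
        fix q :: int assume q: "2 ^ n \<le> q" "q \<le> 8 * 2 ^ n"
        have "(0::int) < 2 ^ n" by simp
        with q have "0 < q" "q < 9 * 2 ^ n" by linarith+
        then show "0 < q \<and> real_of_int q < 9 * 2 ^ n"
          by (metis of_int_less_iff of_int_mult of_int_numeral of_int_power)
      qed
    qed (rule card_coprime_fractions_le, use h in auto)
    have fbad: "finite bad" unfolding bad_def by auto
    have cover: "cball \<xi> h \<subseteq> (\<Union>j\<in>bad. ball (c j) (r j)) \<union> (\<Union>j\<in>G n. ball (c j) (r j))"
    proof
      fix \<alpha> assume "\<alpha> \<in> cball \<xi> h"
      then have \<alpha>: "\<bar>\<alpha> - \<xi>\<bar> \<le> h" by (simp add: dist_real_def)
      obtain p q where pq: "coprime p q" "0 < q" "q \<le> int N" "\<bar>of_int q * \<alpha> - of_int p\<bar> < 1 / N"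
        by (rule Dirichlet_approx_coprime[OF N])
      have q1: "1 \<le> real_of_int q" using pq(2) by simp
      have eq: "\<bar>p / q - \<alpha>\<bar> = \<bar>of_int q * \<alpha> - of_int p\<bar> / q"
        using pq(2) by (simp add: field_simps abs_if)
      have d: "\<bar>p / q - \<alpha>\<bar> < r (p, q)"
        unfolding eq using divide_strict_right_mono[OF pq(4), of "real_of_int q"] q1 by (simp add: r_def mult.commute)
      then have mem: "\<alpha> \<in> ball (c (p, q)) (r (p, q))" by (simp add: c_def dist_real_def)
      have N1: "1 / real N \<le> 1" using N by simp
      show "\<alpha> \<in> (\<Union>j\<in>bad. ball (c j) (r j)) \<union> (\<Union>j\<in>G n. ball (c j) (r j))"
      proof (cases "q < 2 ^ n")
        case True
        have "\<bar>q * \<alpha> - q * \<xi>\<bar> = q * \<bar>\<alpha> - \<xi>\<bar>"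
          using q1 by (simp add: abs_mult flip: right_diff_distrib)
        also have "\<dots> \<le> q * h" using \<alpha> q1 by (intro mult_left_mono) auto
        finally have "\<bar>p - q * \<xi>\<bar> \<le> q * h + 1" using pq(4) N1 by linarith
        then have "(nat q, p) \<in> (SIGMA q:{1..<2 ^ n}. {\<lceil>q * \<xi> - q * h - 1\<rceil>..\<lfloor>q * \<xi> + q * h + 1\<rfloor>})"
          using True pq(2) by (simp add: nat_less_iff Suc_leI) linarith
        then have "(p, q) \<in> bad" unfolding bad_def by (rule rev_image_eqI) (use pq(2) in simp)
        then show ?thesis using mem by blast
      next
        case False
        \<comment> \<open>The radius is below \<open>h\<close>, so the centre of the ball is within
          \<open>2 h\<close> of \<open>\<xi>\<close>.\<close>
        have "r (p, q) \<le> 1 / N" unfolding r_def using q1 N by (simp add: field_simps)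
        also have "\<dots> \<le> (1/2) ^ n" by (simp add: N' power_one_over field_simps)
        finally have "\<bar>p / q - \<xi>\<bar> \<le> 2 * h" using d \<alpha> elim(2) by linarith
        then have "(p, q) \<in> G n" unfolding G_def using False pq by (auto simp: N_def)
        then show ?thesis using mem by blast
      qed
    qed
    have rpos: "0 \<le> r j" if "j \<in> bad \<union> G n" for j
    proof -
      have "(0::int) < 2 ^ n" by simp
      then have "0 \<le> snd j"
        using that unfolding bad_def G_def by (auto simp del: zero_less_power)
      then show ?thesis by (auto simp: r_def split: prod.splits)
    qed
    have "2 * h = measure lebesgue (cball \<xi> h)" using h by (simp add: cball_eq_atLeastAtMost)
    also have "\<dots> \<le> measure lebesgue ((\<Union>j\<in>bad. ball (c j) (r j)) \<union> (\<Union>j\<in>G n. ball (c j) (r j)))"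
      using cover fbad fG by (intro measure_mono_fmeasurable fmeasurable.Un fmeasurable.finite_UN) auto
    also have "\<dots> \<le> measure lebesgue (\<Union>j\<in>bad. ball (c j) (r j)) + measure lebesgue (\<Union>j\<in>G n. ball (c j) (r j))"
      using fbad fG by (intro measure_Un_le sets.finite_UN) auto
    also have "\<dots> \<le> (\<Sum>j\<in>bad. 2 * r j) + (\<Sum>j\<in>G n. 2 * r j)"
      using fbad fG rpos by (intro add_mono measure_UN_ball_le) auto
    also have "(\<Sum>j\<in>G n. 2 * r j) \<le> (\<Sum>j\<in>G n. 1 / (4 * 4 ^ n))"
    proof (intro sum_mono)
      fix j assume "j \<in> G n"
      then obtain p q where j: "j = (p, q)" "2 ^ n \<le> q" by (auto simp: G_def)
      from j(2) have "(2 ^ n :: real) \<le> real_of_int q" by (metis of_int_le_iff of_int_numeral of_int_power)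
      then have "2 ^ n * real N \<le> real_of_int q * real N" by (intro mult_right_mono) auto
      then have "1 / (real_of_int q * real N) \<le> 1 / (2 ^ n * real N)"
        using N by (intro divide_left_mono) (auto intro!: mult_pos_pos less_le_trans[OF _ \<open>2 ^ n \<le> real_of_int q\<close>])
      also have "\<dots> = 1 / (8 * 4 ^ n)" unfolding N' by (simp add: power_mult_distrib[symmetric])
      finally show "2 * r j \<le> 1 / (4 * 4 ^ n)" by (simp add: j r_def)
    qed
    also have "(\<Sum>j\<in>G n. 1 / (4 * 4 ^ n)) = card (G n) / (4 * 4 ^ n)" by simp
    also have "(\<Sum>j\<in>bad. 2 * r j) = (\<Sum>(q, p)\<in>(SIGMA q:{1..<2 ^ n::nat}. {\<lceil>q * \<xi> - q * h - 1\<rceil>..\<lfloor>q * \<xi> + q * h + 1\<rfloor>}). 2 * r (p, int q))"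
      unfolding bad_def by (subst sum.reindex) (auto simp: inj_on_def case_prod_unfold)
    also have "\<dots> = (\<Sum>q\<in>{1..<2 ^ n::nat}. \<Sum>p\<in>{\<lceil>q * \<xi> - q * h - 1\<rceil>..\<lfloor>q * \<xi> + q * h + 1\<rfloor>}. 2 / (real q * real N))"
      by (subst sum.Sigma[symmetric]) (auto simp: r_def)
    also have "\<dots> \<le> (\<Sum>q\<in>{1..<2 ^ n::nat}. 4 * h / N + 6 / N * (1 / q))"
    proof (intro sum_mono)
      fix q :: nat assume q: "q \<in> {1..<2 ^ n}"
      have "0 \<le> q * h" using h by simp
      then have "real (nat (\<lfloor>q * \<xi> + q * h + 1\<rfloor> + 1 - \<lceil>q * \<xi> - q * h - 1\<rceil>)) \<le> 2 * (q * h) + 3"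
        by linarith
      then have "real (nat (\<lfloor>q * \<xi> + q * h + 1\<rfloor> + 1 - \<lceil>q * \<xi> - q * h - 1\<rceil>)) * (2 / (real q * real N))
          \<le> (2 * (q * h) + 3) * (2 / (real q * real N))" by (rule mult_right_mono) simp
      also have "\<dots> = 4 * h / N + 6 / N * (1 / q)" using q N by (simp add: field_simps)
      finally show "(\<Sum>p\<in>{\<lceil>q * \<xi> - q * h - 1\<rceil>..\<lfloor>q * \<xi> + q * h + 1\<rfloor>}. 2 / (real q * real N)) \<le> 4 * h / N + 6 / N * (1 / q)"
        by simp
    qed
    also have "\<dots> = (2 ^ n - 1) * (4 * h / N) + 6 / N * (\<Sum>q\<in>{1..<2 ^ n::nat}. 1 / q)"
      by (simp add: sum.distrib sum_distrib_left of_nat_diff)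
    also have "\<dots> \<le> 2 ^ n * (4 * h / N) + 6 / N * n"
      using h sum_inverse_less_power2[of n] by (intro add_mono mult_mono sum_nonneg) auto
    also have "\<dots> = h / 2 + 6 / 8 * (n * (1/2) ^ n)" by (simp add: N' power_one_over)
    also have "\<dots> \<le> h / 2 + h / 2" using elim(1) h by simp
    \<comment> \<open>The \<open>bad\<close> balls cover at most \<open>h\<close> of the total
      length \<open>2 h\<close>. The balls of \<open>G n\<close>, each of length at most
      \<open>1 / (4 * 4^n)\<close>, must cover the rest.\<close>
    finally have "h \<le> card (G n) / (4 * 4 ^ n)" by simp
    then show "4 * h * 4 ^ n \<le> card (G n)" by (simp add: field_simps)
  qed
qed

section \<open>A divergence theorem for shifted fractions\<close>

lemma sum_power4_le: "(\<Sum>m\<le>n. 4 ^ m / 4 ^ n) \<le> (4/3 :: real)"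
proof -
  have "(\<Sum>m\<le>n. 4 ^ m) \<le> (4/3 :: real) * 4 ^ n" by (induction n) auto
  then have "(\<Sum>m\<le>n. 4 ^ m) / 4 ^ n \<le> (4/3 :: real)" by (simp add: field_simps)
  then show ?thesis by (simp add: sum_divide_distrib)
qed

text \<open>Consecutive blocks overlap: the ratio \<open>8\<close> between the bounds on \<open>q\<close> is what makes the lower count
  above work, and the second-moment argument tolerates the repetitions.\<close>
definition fracs :: "nat \<Rightarrow> (int \<times> int) set" where
  "fracs n = {(p, q). coprime p q \<and> 2 ^ n \<le> q \<and> q \<le> 8 * 2 ^ n}"

lemma fracsD:
  assumes "(p, q) \<in> fracs n"
  shows "coprime p q" "0 < q" "2 ^ n \<le> real_of_int q" "real_of_int q \<le> 8 * 2 ^ n" "1 / real_of_int q ^ 2 \<le> 1 / 4 ^ n"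
proof -
  show "coprime p q" using assms by (simp add: fracs_def)
  have q: "2 ^ n \<le> q" "q \<le> 8 * 2 ^ n" using assms by (auto simp: fracs_def)
  have "(0 :: int) < 2 ^ n" by simp
  with q(1) show "0 < q" by linarith
  show q1: "2 ^ n \<le> real_of_int q" using q(1) by (metis of_int_le_iff of_int_numeral of_int_power)
  show "real_of_int q \<le> 8 * 2 ^ n"
    using q(2) by (metis of_int_le_iff of_int_mult of_int_numeral of_int_power)
  have "(2 ^ n)\<^sup>2 \<le> real_of_int q ^ 2" using q1 by (intro power_mono) auto
  then have "4 ^ n \<le> real_of_int q ^ 2" by (simp add: power2_eq_square power_mult_distrib[symmetric])
  then show "1 / real_of_int q ^ 2 \<le> 1 / 4 ^ n" by (intro divide_left_mono) (use \<open>0 < q\<close> in auto)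
qed

lemma card_fracs_near_le:
  assumes "R \<ge> 0"
  shows "finite {v \<in> fracs n. \<bar>real_of_int (fst v) / real_of_int (snd v) - \<xi>\<bar> \<le> R}"
    "real (card {v \<in> fracs n. \<bar>real_of_int (fst v) / real_of_int (snd v) - \<xi>\<bar> \<le> R}) \<le> 162 * R * 4 ^ n + 2"
proof -
  \<comment> \<open>The factor 9 makes the bound \<open>q \<le> 8 * 2^n\<close> strict, and
    \<open>162 = 2 * 9^2\<close>.\<close>
  let ?S = "{(p :: int, q :: int). coprime p q \<and> 0 < q \<and> q < (9 * 2 ^ n :: real) \<and> \<bar>p / q - \<xi>\<bar> \<le> R}"
  have sub: "{v \<in> fracs n. \<bar>real_of_int (fst v) / real_of_int (snd v) - \<xi>\<bar> \<le> R} \<subseteq> ?S"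
  proof (clarsimp, intro conjI)
    fix p q assume "(p, q) \<in> fracs n"
    note f = fracsD[OF this]
    show "coprime p q" "0 < q" by (rule f)+
    have "(0 :: real) < 2 ^ n" by simp
    with f(4) show "real_of_int q < 9 * 2 ^ n" by linarith
  qed
  have S: "finite ?S" "real (card ?S) \<le> 2 * R * (9 * 2 ^ n)\<^sup>2 + 2"
    by (rule card_coprime_fractions_le; use assms in simp)+
  show "finite {v \<in> fracs n. \<bar>real_of_int (fst v) / real_of_int (snd v) - \<xi>\<bar> \<le> R}" using sub S(1) by (rule finite_subset)
  have "real (card {v \<in> fracs n. \<bar>real_of_int (fst v) / real_of_int (snd v) - \<xi>\<bar> \<le> R}) \<le> real (card ?S)"
    using sub S(1) by (simp add: card_mono)
  also have "\<dots> \<le> 2 * R * (9 * 2 ^ n)\<^sup>2 + 2" by (rule S)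
  also have "(9 * 2 ^ n :: real)\<^sup>2 = 81 * 4 ^ n"
    by (simp add: power2_eq_square power_mult_distrib[symmetric])
  finally show "real (card {v \<in> fracs n. \<bar>real_of_int (fst v) / real_of_int (snd v) - \<xi>\<bar> \<le> R}) \<le> 162 * R * 4 ^ n + 2" by simp
qed

text \<open>Here \<open>x\<close> stands for the real parts of the hexagonal points and
  \<open>e n\<close> for the value of \<open>eps\<close> at times of order \<open>2^n\<close>. The
  distance from \<open>x (p, q)\<close> to \<open>p/q\<close> is small enough for counts of reduced
  fractions to carry over to the shifted points.\<close>

locale shifted_fractions =
  fixes e :: "nat \<Rightarrow> real" and x :: "int \<times> int \<Rightarrow> real"
  assumes e: "0 \<le> e n" "e n \<le> 1"
    and not_summable: "\<not> summable e"
    and x: "\<lbrakk>coprime p q; q > 0\<rbrakk> \<Longrightarrow> \<bar>x (p, q) - p / q\<bar> \<le> 1 / real_of_int q ^ 2"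
begin

text \<open>A hexagonal point next to \<open>p/q\<close> with \<open>q \<le> 8 * 2^n\<close> has
  height \<open>Y \<ge> 1/(4 q^2) \<ge> 1/(256 * 4^n)\<close>, so \<open>r n \<le> e n * Y\<close>
  throughout the block.\<close>

definition r :: "nat \<Rightarrow> real" where "r n = e n / (256 * 4 ^ n)"

lemma r_nonneg: "0 \<le> r n" using e by (simp add: r_def)

lemma r_le: "r n \<le> 1 / 4 ^ n"
  unfolding r_def using e[of n] by (intro frac_le) auto

lemma x_close: "v \<in> fracs n \<Longrightarrow> \<bar>x v - real_of_int (fst v) / real_of_int (snd v)\<bar> \<le> 1 / 4 ^ n"
  using x fracsD by (cases v) (fastforce intro: order_trans)

text \<open>Spacing limits the number of centres whose ball can meet the given one, and each overlap
  has length at most \<open>2 * r n\<close>. The first term has the order that independence would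
  give; the second accounts for the boundedly many centres that spacing cannot exclude.\<close>

lemma overlap_le:
  assumes fin: "finite W" and W: "W \<subseteq> fracs n"
  shows "(\<Sum>w\<in>W. measure lebesgue (ball y (r m) \<inter> ball (x w) (r n))) \<le> e n * e m / 4 ^ m + 3 * e n / 4 ^ n"
proof -
  \<comment> \<open>The summand \<open>2 / 4^n\<close> covers the radius \<open>r n\<close> and the
    shift of \<open>x w\<close> from its fraction, each at most \<open>1 / 4^n\<close>.\<close>
  let ?R = "r m + 2 / 4 ^ n"
  let ?V = "{w \<in> fracs n. \<bar>real_of_int (fst w) / real_of_int (snd w) - y\<bar> \<le> ?R}"
  have R: "?R \<ge> 0" using r_nonneg[of m] by simp
  have z: "measure lebesgue (ball y (r m) \<inter> ball (x w) (r n)) = 0" if "w \<in> W - ?V" for w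
  proof -
    have "ball y (r m) \<inter> ball (x w) (r n) = {}"
    proof (rule ccontr)
      assume "ball y (r m) \<inter> ball (x w) (r n) \<noteq> {}"
      then obtain u where "\<bar>y - u\<bar> < r m" "\<bar>x w - u\<bar> < r n" by (auto simp: dist_real_def)
      moreover have "\<bar>x w - real_of_int (fst w) / real_of_int (snd w)\<bar> \<le> 1 / 4 ^ n" using W that by (intro x_close) auto
      ultimately have "\<bar>real_of_int (fst w) / real_of_int (snd w) - y\<bar> \<le> ?R" using r_le[of n] by linarith
      then show False using that W by auto
    qed
    then show ?thesis by simp
  qed
  have "(\<Sum>w\<in>W. measure lebesgue (ball y (r m) \<inter> ball (x w) (r n))) =
      (\<Sum>w\<in>W \<inter> ?V. measure lebesgue (ball y (r m) \<inter> ball (x w) (r n)))"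
    using fin z by (intro sum.mono_neutral_right) auto
  also have "\<dots> \<le> (\<Sum>w\<in>W \<inter> ?V. 2 * r n)"
  proof (intro sum_mono)
    fix w
    have "measure lebesgue (ball y (r m) \<inter> ball (x w) (r n)) \<le> measure lebesgue (ball (x w) (r n))"
      by (intro measure_mono_fmeasurable) auto
    also have "\<dots> = 2 * r n" using r_nonneg[of n] by (simp add: ball_eq_greaterThanLessThan)
    finally show "measure lebesgue (ball y (r m) \<inter> ball (x w) (r n)) \<le> 2 * r n" .
  qed
  also have "\<dots> = card (W \<inter> ?V) * (2 * r n)" by simp
  also have "\<dots> \<le> (162 * ?R * 4 ^ n + 2) * (2 * r n)"
  proof (rule mult_right_mono)
    have "real (card (W \<inter> ?V)) \<le> card ?V"
      using card_fracs_near_le(1)[OF R] by (simp add: card_mono)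
    also have "\<dots> \<le> 162 * ?R * 4 ^ n + 2" by (rule card_fracs_near_le(2)[OF R])
    finally show "real (card (W \<inter> ?V)) \<le> 162 * ?R * 4 ^ n + 2" .
  qed (use r_nonneg in simp)
  also have "\<dots> = (162 * r m * 4 ^ n + 326) * (2 * r n)" by (simp add: algebra_simps)
  also have "\<dots> = (324 / 65536) * (e n * e m / 4 ^ m) + (652 / 256) * (e n / 4 ^ n)"
    unfolding r_def by (simp add: field_simps)
  also have "\<dots> \<le> 1 * (e n * e m / 4 ^ m) + 3 * (e n / 4 ^ n)"
    using e by (intro add_mono mult_right_mono) auto
  finally show ?thesis by simp
qed

text \<open>The Chung-Erdos inequality on a finite range of scales with
  \<open>S = \<Sum> e n \<ge> 1\<close>. The lengths add up to at least \<open>h S / 32\<close> and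
  the pairwise overlaps to at most \<open>2934 h S^2\<close>, so \<open>S\<close> cancels and
  \<open>3004416 = 32^2 * 2934\<close> remains.\<close>

lemma measure_hits_ge:
  assumes h: "h > 0"
  shows "\<exists>J. finite J \<and> (\<forall>(n, v)\<in>J. N \<le> n \<and> v \<in> fracs n) \<and>
    (\<Union>(n, v)\<in>J. ball (x v) (r n)) \<subseteq> ball \<xi> (3 * h) \<and>
    h / 3004416 \<le> measure lebesgue (\<Union>(n, v)\<in>J. ball (x v) (r n))"
proof -
  define G where "G n = {v \<in> fracs n. \<bar>real_of_int (fst v) / real_of_int (snd v) - \<xi>\<bar> \<le> 2 * h}" for n
  have "(\<lambda>n. 1 / 4 ^ n :: real) \<longlonglongrightarrow> 0"
    using LIMSEQ_power_zero[of "1/4::real"] by (simp add: power_one_over)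
  then have "\<forall>\<^sub>F n in sequentially. 1 / 4 ^ n < h / 2"
    using h by (intro order_tendstoD) auto
  moreover have "\<forall>\<^sub>F n in sequentially. 4 * h * 4 ^ n \<le> real (card (G n))"
    using card_coprime_fractions_ge[OF h, of \<xi>]
    by (rule eventually_mono) (auto simp: G_def fracs_def case_prod_unfold cong: conj_cong)
  ultimately have "\<forall>\<^sub>F n in sequentially. 1 / 4 ^ n < h / 2 \<and> 4 * h * 4 ^ n \<le> real (card (G n))"
    by (rule eventually_conj)
  then obtain n0 where n0: "\<And>n. n \<ge> n0 \<Longrightarrow> 1 / 4 ^ n < h / 2 \<and> 4 * h * 4 ^ n \<le> real (card (G n))"
    by (auto simp: eventually_sequentially)
  define n1 where "n1 = max n0 N"
  \<comment> \<open>Divergence gives \<open>S \<ge> 1\<close>, so that terms linear in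
    \<open>S\<close> can be absorbed into \<open>S^2\<close>.\<close>
  obtain M where M: "1 \<le> (\<Sum>n\<in>{n1..<M}. e n)"
  proof -
    have "\<not> summable (\<lambda>n. e (n + n1))" using not_summable by (simp add: summable_iff_shift)
    then have "\<not> (\<forall>k. (\<Sum>n\<le>k. e (n + n1)) \<le> 1)"
      using bounded_imp_summable[of "\<lambda>n. e (n + n1)" 1] e(1) by blast
    then obtain k where "\<not> (\<Sum>n<Suc k. e (n + n1)) \<le> 1" by (auto simp: lessThan_Suc_atMost)
    then have "1 \<le> (\<Sum>n<Suc k. e (n + n1))" by linarith
    also have "\<dots> = (\<Sum>n\<in>{n1..<n1 + Suc k}. e n)"
      by (rule sum.reindex_bij_witness[of _ "\<lambda>n. n - n1" "\<lambda>n. n + n1"]) auto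
    finally show thesis using that by blast
  qed
  define I where "I = {n1..<M}"
  define S where "S = (\<Sum>n\<in>I. e n)"
  have S: "1 \<le> S" using M by (simp add: S_def I_def)
  have finG: "finite (G n)" for n unfolding G_def using h by (intro card_fracs_near_le) simp
  have IG: "1 / 4 ^ n < h / 2" "4 * h * 4 ^ n \<le> real (card (G n))" if "n \<in> I" for n
    using n0[of n] that by (auto simp: I_def n1_def)
  have Gup: "real (card (G n)) \<le> 326 * h * 4 ^ n" if "n \<in> I" for n
  proof -
    have "real (card (G n)) \<le> 162 * (2 * h) * 4 ^ n + 2"
      unfolding G_def using h by (intro card_fracs_near_le) simp
    moreover have "2 < h * 4 ^ n" using IG(1)[OF that] by (simp add: field_simps)
    ultimately show ?thesis by linarith
  qed
  define J where "J = (SIGMA n:I. G n)"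
  define B where "B = (\<lambda>(n, v). ball (x v) (r n))"
  have finJ: "finite J" unfolding J_def using finG by (intro finite_SigmaI) (auto simp: I_def)
  have Bm: "B j \<in> lmeasurable" for j by (cases j) (simp add: B_def)
  have sub: "(\<Union>j\<in>J. B j) \<subseteq> ball \<xi> (3 * h)"
  proof (clarsimp simp: J_def B_def dist_real_def)
    fix n p q u assume nv: "n \<in> I" "(p, q) \<in> G n" and u: "\<bar>x (p, q) - u\<bar> < r n"
    have "\<bar>p / q - \<xi>\<bar> \<le> 2 * h" "\<bar>x (p, q) - p / q\<bar> \<le> 1 / 4 ^ n"
      using nv x_close[of "(p, q)" n] by (auto simp: G_def)
    then show "\<bar>\<xi> - u\<bar> < 3 * h" using u r_le[of n] IG(1)[OF nv(1)] by linarith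
  qed
  have sumJ: "(\<Sum>i\<in>J. f i) = (\<Sum>m\<in>I. \<Sum>v\<in>G m. f (m, v))" for f :: "_ \<Rightarrow> real"
    unfolding J_def using finG by (subst sum.Sigma) (auto simp: I_def)
  have S1: "h / 32 * S \<le> (\<Sum>j\<in>J. measure lebesgue (B j))"
  proof -
    have "h / 32 * S = (\<Sum>n\<in>I. (4 * h * 4 ^ n) * (2 * r n))"
      unfolding S_def r_def by (simp add: sum_distrib_left)
    also have "\<dots> \<le> (\<Sum>n\<in>I. card (G n) * (2 * r n))"
      using IG(2) r_nonneg by (intro sum_mono mult_right_mono) auto
    also have "\<dots> = (\<Sum>n\<in>I. \<Sum>v\<in>G n. measure lebesgue (B (n, v)))"
      using r_nonneg by (simp add: B_def ball_eq_greaterThanLessThan)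
    also have "\<dots> = (\<Sum>j\<in>J. measure lebesgue (B j))"
      by (simp only: sumJ)
    finally show ?thesis .
  qed
  define T where "T m n = (\<Sum>v\<in>G m. \<Sum>w\<in>G n. measure lebesgue (B (m, v) \<inter> B (n, w)))" for m n
  \<comment> \<open>The second term of \<open>overlap_le\<close>, of order \<open>e n / 4^n\<close>,
    occurs once for each of the roughly \<open>h * 4^m\<close> centres in \<open>G m\<close>. Over
    \<open>m \<le> n\<close> the ratios form a geometric series, so this part of the second moment
    is only linear in \<open>S\<close>.\<close>
  define k where "k m n = (if m \<le> n then 4 ^ m / 4 ^ n else 0 :: real)" for m n :: nat
  have kpos: "0 \<le> k m n" for m n by (simp add: k_def)
  have Tle: "T m n \<le> 326 * h * (e m * e n + 3 * e n * k m n)" if "m \<in> I" "m \<le> n" for m n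
  proof -
    have "T m n \<le> (\<Sum>v\<in>G m. e n * e m / 4 ^ m + 3 * e n / 4 ^ n)"
      unfolding T_def B_def prod.case
      using finG by (intro sum_mono overlap_le) (auto simp: G_def)
    also have "\<dots> = card (G m) * (e n * e m / 4 ^ m + 3 * e n / 4 ^ n)" by simp
    also have "\<dots> \<le> (326 * h * 4 ^ m) * (e n * e m / 4 ^ m + 3 * e n / 4 ^ n)"
      using Gup[OF that(1)] e by (intro mult_right_mono) auto
    also have "\<dots> = 326 * h * (e m * e n + 3 * e n * k m n)"
      using that by (simp add: k_def field_simps)
    finally show ?thesis .
  qed
  have Tsym: "T m n = T n m" for m n
    unfolding T_def by (subst sum.swap) (simp add: Int_commute)
  \<comment> \<open>\<open>Tle\<close> needs the coarser scale first. Adding the kernels for both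
    orders avoids splitting the double sum.\<close>
  have Tle': "T m n \<le> 326 * h * (e m * e n + 3 * e n * k m n + 3 * e m * k n m)" if "m \<in> I" "n \<in> I" for m n
  proof (cases "m \<le> n")
    case True
    have "0 \<le> e m * k n m" using e kpos by simp
    then have "326 * h * (e m * e n + 3 * e n * k m n) \<le> 326 * h * (e m * e n + 3 * e n * k m n + 3 * e m * k n m)"
      using h by (intro mult_left_mono) auto
    with Tle[OF that(1) True] show ?thesis by linarith
  next
    case False
    have "0 \<le> e n * k m n" using e kpos by simp
    then have "326 * h * (e n * e m + 3 * e m * k n m) \<le> 326 * h * (e m * e n + 3 * e n * k m n + 3 * e m * k n m)"
      using h by (intro mult_left_mono) (auto simp: mult.commute)
    with Tle[OF that(2), of m] False Tsym[of m n] show ?thesis by simp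
  qed
  have ksum: "(\<Sum>m\<in>I. k m n) \<le> 4 / 3" for n
  proof -
    have "(\<Sum>m\<in>I. k m n) = (\<Sum>m\<in>{m \<in> I. m \<le> n}. 4 ^ m / 4 ^ n)"
      unfolding k_def by (subst sum.inter_filter[symmetric]) (auto simp: I_def)
    also have "\<dots> \<le> (\<Sum>m\<le>n. 4 ^ m / 4 ^ n)" by (intro sum_mono2) auto
    also have "\<dots> \<le> 4 / 3" by (rule sum_power4_le)
    finally show ?thesis .
  qed
  have kS: "(\<Sum>m\<in>I. \<Sum>n\<in>I. e n * k m n) \<le> 4 / 3 * S"
  proof -
    have "(\<Sum>m\<in>I. \<Sum>n\<in>I. e n * k m n) = (\<Sum>n\<in>I. e n * (\<Sum>m\<in>I. k m n))"
      by (subst sum.swap) (simp add: sum_distrib_left)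
    also have "\<dots> \<le> (\<Sum>n\<in>I. e n * (4 / 3))" using ksum e by (intro sum_mono mult_left_mono) auto
    also have "\<dots> = S * (4 / 3)" unfolding S_def by (rule sum_distrib_right[symmetric])
    finally show ?thesis by simp
  qed
  have kS': "(\<Sum>m\<in>I. \<Sum>n\<in>I. e m * k n m) \<le> 4 / 3 * S"
    using kS by (subst sum.swap)
  have "(\<Sum>i\<in>J. \<Sum>j\<in>J. measure lebesgue (B i \<inter> B j)) = (\<Sum>m\<in>I. \<Sum>v\<in>G m. \<Sum>n\<in>I. \<Sum>w\<in>G n. measure lebesgue (B (m, v) \<inter> B (n, w)))"
    by (simp only: sumJ)
  also have "\<dots> = (\<Sum>m\<in>I. \<Sum>n\<in>I. T m n)"
    unfolding T_def by (intro sum.cong refl sum.swap)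
  also have "\<dots> \<le> (\<Sum>m\<in>I. \<Sum>n\<in>I. 326 * h * (e m * e n + 3 * e n * k m n + 3 * e m * k n m))"
    by (intro sum_mono Tle')
  also have "\<dots> = 326 * h * ((\<Sum>m\<in>I. \<Sum>n\<in>I. e m * e n) + 3 * (\<Sum>m\<in>I. \<Sum>n\<in>I. e n * k m n) + 3 * (\<Sum>m\<in>I. \<Sum>n\<in>I. e m * k n m))"
    by (simp only: sum_distrib_left sum.distrib[symmetric] mult.assoc)
  also have "\<dots> \<le> 326 * h * (S * S + 3 * (4 / 3 * S) + 3 * (4 / 3 * S))"
    using h kS kS' by (intro mult_left_mono add_mono) (auto simp: S_def sum_product)
  also have "\<dots> \<le> 326 * h * (9 * (S * S))"
  proof (rule mult_left_mono)
    have "1 * S \<le> S * S" using S by (intro mult_right_mono) auto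
    then show "S * S + 3 * (4 / 3 * S) + 3 * (4 / 3 * S) \<le> 9 * (S * S)" by simp
  qed (use h in simp)
  finally have D: "(\<Sum>i\<in>J. \<Sum>j\<in>J. measure lebesgue (B i \<inter> B j)) \<le> 2934 * h * (S * S)" by simp
  have "(h / 32 * S)\<^sup>2 \<le> (\<Sum>j\<in>J. measure lebesgue (B j))\<^sup>2"
    using S1 h S by (intro power_mono) auto
  also have "\<dots> \<le> measure lebesgue (\<Union>j\<in>J. B j) * (\<Sum>i\<in>J. \<Sum>j\<in>J. measure lebesgue (B i \<inter> B j))"
    using finJ Bm by (rule Chung_Erdos_inequality)
  also have "\<dots> \<le> measure lebesgue (\<Union>j\<in>J. B j) * (2934 * h * (S * S))"
    using D by (intro mult_left_mono) auto
  finally have "(h / 32 * S)\<^sup>2 \<le> measure lebesgue (\<Union>j\<in>J. B j) * (2934 * h * (S * S))" .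
  moreover have "(h / 32 * S)\<^sup>2 = h * (h * (S * S)) / 1024" by (simp add: power2_eq_square)
  ultimately have "h * (h * (S * S)) \<le> measure lebesgue (\<Union>j\<in>J. B j) * 3004416 * (h * (S * S))"
    by simp
  moreover have "0 < h * (S * S)" using h S by simp
  ultimately have "h \<le> measure lebesgue (\<Union>j\<in>J. B j) * 3004416"
    by (simp only: mult_le_cancel_right_pos)
  then have "h / 3004416 \<le> measure lebesgue (\<Union>j\<in>J. B j)" by simp
  with finJ sub show ?thesis
    by (intro exI[of _ J]) (auto simp: B_def J_def I_def n1_def G_def)
qed

text \<open>Each \<open>F N\<close> misses at least the proportion
  \<open>(h / 3004416) / (6 h) = 1 / 18026496\<close> of every ball, by
  \<open>measure_hits_ge\<close>, and is therefore null by the density lemma. The set in question is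
  contained in the union of the \<open>F N\<close>.\<close>

theorem negligible_finitely_often:
  "negligible {\<alpha>. \<forall>\<^sub>F n in sequentially. \<forall>v\<in>fracs n. \<alpha> \<notin> ball (x v) (r n)}"
proof -
  define F where "F N = - (\<Union>n\<in>{N..}. \<Union>v\<in>fracs n. ball (x v) (r n))" for N
  have "negligible (F N)" for N
  proof (rule negligible_if_density_le[where \<theta> = "1 - 1 / 18026496"])
    have "closed (F N)" unfolding F_def closed_Compl by (intro closed_Compl open_UN ballI open_ball)
    then show Fm: "F N \<in> sets lebesgue" by (simp add: borel_closed)
    fix \<xi> d :: real assume "d > 0"
    define h where "h = d / 6"
    have h: "h > 0" using \<open>d > 0\<close> by (simp add: h_def)
    obtain J where J: "finite J" "\<forall>(n, v)\<in>J. N \<le> n \<and> v \<in> fracs n"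
      "(\<Union>(n, v)\<in>J. ball (x v) (r n)) \<subseteq> ball \<xi> (3 * h)"
      "h / 3004416 \<le> measure lebesgue (\<Union>(n, v)\<in>J. ball (x v) (r n))"
      using measure_hits_ge[OF h, where N = N and \<xi> = \<xi>] by (elim exE conjE) (rule that)
    define U where "U = (\<Union>(n, v)\<in>J. ball (x v) (r n))"
    have Um: "U \<in> lmeasurable" unfolding U_def using J(1) by (intro fmeasurable.finite_UN) auto
    have "F N \<inter> ball \<xi> (3 * h) \<subseteq> ball \<xi> (3 * h) - U"
      using J(2) by (fastforce simp: F_def U_def)
    then have "measure lebesgue (F N \<inter> ball \<xi> (3 * h)) \<le> measure lebesgue (ball \<xi> (3 * h) - U)"
      using Um Fm by (intro measure_mono_fmeasurable) auto
    also have "\<dots> = measure lebesgue (ball \<xi> (3 * h)) - measure lebesgue U"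
      using Um J(3) by (intro measurable_measure_Diff) (auto simp: U_def)
    also have "\<dots> \<le> 6 * h - h / 3004416"
      using J(4) h by (simp add: U_def ball_eq_greaterThanLessThan)
    also have "\<dots> = (1 - 1 / 18026496) * measure lebesgue (ball \<xi> (3 * h))"
      using h by (simp add: ball_eq_greaterThanLessThan)
    finally have m: "measure lebesgue (F N \<inter> ball \<xi> (3 * h)) \<le> (1 - 1 / 18026496) * measure lebesgue (ball \<xi> (3 * h))" .
    have "emeasure lebesgue (F N \<inter> ball \<xi> (3 * h)) = ennreal (measure lebesgue (F N \<inter> ball \<xi> (3 * h)))"
      using Fm by (intro emeasure_eq_measure2 bounded_set_imp_lmeasurable) auto
    also have "\<dots> \<le> ennreal ((1 - 1 / 18026496) * measure lebesgue (ball \<xi> (3 * h)))"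
      using m by (rule ennreal_leI)
    also have "\<dots> = ennreal (1 - 1 / 18026496) * emeasure lebesgue (ball \<xi> (3 * h))"
      by (subst ennreal_mult) (auto simp: emeasure_eq_measure2)
    finally show "\<exists>r. 0 < r \<and> r < d \<and> emeasure lebesgue (F N \<inter> ball \<xi> r)
        \<le> ennreal (1 - 1 / 18026496) * emeasure lebesgue (ball \<xi> r)"
      using h by (intro exI[of _ "3 * h"]) (auto simp: h_def)
  qed auto
  then have "negligible (\<Union>N. F N)" by (intro negligible_countable_Union) auto
  then show ?thesis
  proof (rule negligible_subset, intro subsetI)
    fix \<alpha> assume "\<alpha> \<in> {\<alpha>. \<forall>\<^sub>F n in sequentially. \<forall>v\<in>fracs n. \<alpha> \<notin> ball (x v) (r n)}"
    then obtain N where "\<And>n v. n \<ge> N \<Longrightarrow> v \<in> fracs n \<Longrightarrow> \<alpha> \<notin> ball (x v) (r n)"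
      unfolding mem_Collect_eq eventually_sequentially by metis
    then have "\<alpha> \<in> F N" unfolding F_def by blast
    then show "\<alpha> \<in> (\<Union>N. F N)" by blast
  qed
qed

end

section \<open>The divergent case\<close>

lemma not_eventually_at_top_iff:
  fixes a :: "'a::linorder"
  shows "\<not> eventually P at_top \<longleftrightarrow> (\<forall>T. \<exists>t\<ge>max a T. \<not> P t)"
  unfolding eventually_at_top_linorder by (meson max.bounded_iff order_refl)

lemma eventually_le_power:
  fixes a c :: real
  assumes "1 < a"
  shows "\<forall>\<^sub>F n in sequentially. c \<le> a ^ n"
proof -
  obtain N where N: "c < a ^ N" using real_arch_pow[OF assms] by blast
  have "c \<le> a ^ n" if "n \<ge> N" for n
    using N power_increasing[OF that, of a] assms by linarith
  then show ?thesis by (auto simp: eventually_sequentially)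
qed

section \<open>The setting shared by the divergent and the convergent case\<close>

locale approx_function =
  fixes \<psi> :: "real \<Rightarrow> real" and t0 :: real
  assumes t0: "t0 > 0"
    and \<psi>_pos: "\<And>t. t \<ge> t0 \<Longrightarrow> \<psi> t > 0"
    and \<psi>_cont: "continuous_on {t0..} \<psi>"
    and \<psi>_less: "\<forall>\<^sub>F t in at_top. \<psi> t < 1 / t"
    and \<psi>_mono: "mono_on {t0..} (\<lambda>t. t * \<psi> t)"
begin

definition eps :: "real \<Rightarrow> real" where "eps t = 1 - t * \<psi> t"

lemma eps_antimono: "t0 \<le> s \<Longrightarrow> s \<le> t \<Longrightarrow> eps t \<le> eps s"
  using mono_onD[OF \<psi>_mono, of s t] by (simp add: eps_def)

text \<open>The inequality \<open>\<psi> t < 1 / t\<close> is given only eventually; monotonicity of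
  \<open>t * \<psi> t\<close> carries it back to \<open>t0\<close>.\<close>

lemma eps_bounds:
  assumes t: "t \<ge> t0"
  shows "0 < eps t" "eps t < 1"
proof -
  show "eps t < 1" using t t0 \<psi>_pos[OF t] by (simp add: eps_def)
  obtain T where T: "\<And>s. s \<ge> T \<Longrightarrow> \<psi> s < 1 / s" using \<psi>_less by (auto simp: eventually_at_top_linorder)
  have m: "max t T > 0" using t t0 by auto
  have "0 < eps (max t T)" using T[of "max t T"] m by (simp add: eps_def field_simps)
  also have "\<dots> \<le> eps t" using t by (intro eps_antimono) auto
  finally show "0 < eps t" .
qed

text \<open>Absence of short vectors at time \<open>t\<close>, multiplied by
  \<open>\<psi>(t)^2 = (\<psi>(t)/t) (1 - eps t)\<close>. In this shape it is the hexagonal lower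
  bound at height \<open>\<psi>(t)/t\<close>, weakened by the factor \<open>1 - eps t\<close> that
  \<open>form_shift_ge\<close> produces.\<close>

definition sparse :: "real \<Rightarrow> real \<Rightarrow> bool" where
  "sparse \<alpha> t \<longleftrightarrow> (\<forall>p q :: int. p \<noteq> 0 \<or> q \<noteq> 0 \<longrightarrow>
     (\<alpha> * real_of_int q - real_of_int p)\<^sup>2 + (real_of_int q * (\<psi> t / t))\<^sup>2 \<ge> 2 / sqrt 3 * (\<psi> t / t) * (1 - eps t))"

lemma notin_D2_iff:
  "\<alpha> \<notin> D2 \<psi> \<longleftrightarrow> (\<forall>T. \<exists>t\<ge>max t0 T. sparse \<alpha> t)"
proof -
  have key: "(((\<alpha> * real_of_int q - real_of_int p) / \<psi> t)\<^sup>2 + (real_of_int q / t)\<^sup>2 < 2 / sqrt 3) \<longleftrightarrow>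
     \<not> (\<alpha> * real_of_int q - real_of_int p)\<^sup>2 + (real_of_int q * (\<psi> t / t))\<^sup>2 \<ge> 2 / sqrt 3 * (\<psi> t / t) * (1 - eps t)"
    if "t \<ge> t0" for t and p q :: int
  proof -
    have p: "\<psi> t > 0" "t > 0" using \<psi>_pos[OF that] t0 that by auto
    have e1: "((\<alpha> * real_of_int q - real_of_int p) / \<psi> t)\<^sup>2 + (real_of_int q / t)\<^sup>2 =
      ((\<alpha> * real_of_int q - real_of_int p)\<^sup>2 + (real_of_int q * (\<psi> t / t))\<^sup>2) / (\<psi> t)\<^sup>2"
      using p by (simp add: power_divide power_mult_distrib add_divide_distrib)
    have e2: "2 / sqrt 3 * (\<psi> t / t) * (1 - eps t) = 2 / sqrt 3 * (\<psi> t)\<^sup>2"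
      using p by (simp add: eps_def power2_eq_square)
    show ?thesis unfolding e1 e2 using p by (simp add: pos_divide_less_eq not_le)
  qed
  have "\<alpha> \<notin> D2 \<psi> \<longleftrightarrow> (\<forall>T. \<exists>t\<ge>max t0 T. \<not> (\<exists>p q :: int. (p, q) \<noteq> (0, 0) \<and>
     ((\<alpha> * real_of_int q - real_of_int p) / \<psi> t)\<^sup>2 + (real_of_int q / t)\<^sup>2 < 2 / sqrt 3))"
    unfolding D2_def mem_Collect_eq by (rule not_eventually_at_top_iff)
  also have "\<dots> \<longleftrightarrow> (\<forall>T. \<exists>t\<ge>max t0 T. sparse \<alpha> t)"
  proof (intro all_cong1 ex_cong1 conj_cong refl)
    fix T t assume "max t0 T \<le> t"
    then have "t0 \<le> t" by simp
    then show "(\<not> (\<exists>p q :: int. (p, q) \<noteq> (0, 0) \<and>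
     ((\<alpha> * real_of_int q - real_of_int p) / \<psi> t)\<^sup>2 + (real_of_int q / t)\<^sup>2 < 2 / sqrt 3)) \<longleftrightarrow>
     sparse \<alpha> t"
      by (simp only: sparse_def key not_ex de_Morgan_conj not_not prod.inject imp_conv_disj)
  qed
  finally show ?thesis .
qed

text \<open>Intermediate value theorem for the height \<open>\<psi> t / t\<close>, which is at most
  \<open>1 / t^2\<close>. It provides a time whose height is exactly that of a given hexagonal
  point.\<close>

lemma ex_height:
  assumes "0 < Y" "Y \<le> \<psi> t0 / t0"
  shows "\<exists>t\<ge>t0. \<psi> t / t = Y"
proof -
  define b where "b = max t0 (1 / sqrt Y)"
  have b: "t0 \<le> b" "0 < b" using t0 by (auto simp: b_def)
  have "(1 / sqrt Y)\<^sup>2 \<le> b\<^sup>2" using assms by (intro power_mono) (auto simp: b_def)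
  then have Y: "1 / Y \<le> b\<^sup>2" using assms by (simp add: power_divide)
  have "b * \<psi> b \<le> 1" using eps_bounds[OF b(1)] by (simp add: eps_def)
  then have "\<psi> b / b \<le> 1 / b\<^sup>2" using b by (simp add: field_simps power2_eq_square)
  also have "\<dots> \<le> Y" using Y assms b by (simp add: field_simps)
  finally have "\<psi> b / b \<le> Y" .
  moreover have "continuous_on {t0..b} (\<lambda>t. \<psi> t / t)"
    using t0 by (intro continuous_intros continuous_on_subset[OF \<psi>_cont]) auto
  ultimately show ?thesis
    using IVT2'[of "\<lambda>t. \<psi> t / t" b Y t0] assms b by auto
qed

text \<open>Cauchy condensation for \<open>1/k - \<psi>(k) = eps k / k\<close>, a nonnegative and
  non-increasing sequence.\<close>

lemma summable_eps_iff:
  "summable (\<lambda>n. eps (max t0 (2 ^ n))) \<longleftrightarrow>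
   convergent (\<lambda>n. \<Sum>k = nat \<lceil>t0\<rceil>..n. 1 / real k - \<psi> (real k))"
proof -
  define k0 where "k0 = nat \<lceil>t0\<rceil>"
  have k0: "t0 \<le> real k0" "1 \<le> k0" using t0 unfolding k0_def by linarith+
  \<comment> \<open>The two maxima extend the terms monotonically to indices below
    \<open>k0\<close>, as condensation requires a sequence monotone from the start.\<close>
  define f where "f k = eps (max t0 (real k)) / real (max k0 k)" for k :: nat
  have f0: "f k \<ge> 0" for k using eps_bounds[of "max t0 (real k)"] by (simp add: f_def)
  have fm: "f (Suc k) \<le> f k" for k
    unfolding f_def using k0 eps_bounds[of "max t0 (real k)"]
    by (intro frac_le eps_antimono) auto
  have feq: "f k = 1 / real k - \<psi> (real k)" if "k \<ge> k0" for k
  proof -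
    have "t0 \<le> real k" "0 < real k" using that k0 by (auto intro: order_trans)
    then show ?thesis using that by (simp add: f_def eps_def max_absorb2 diff_divide_distrib)
  qed
  have "summable (\<lambda>n. eps (max t0 (2 ^ n))) \<longleftrightarrow> summable (\<lambda>n. 2 ^ n * f (2 ^ n))"
  proof (rule summable_cong)
    have "k0 \<le> 2 ^ n" if "n \<ge> k0" for n
      using that less_exp[of n] by linarith
    then have "eps (max t0 (2 ^ n)) = 2 ^ n * f (2 ^ n)" if "n \<ge> k0" for n
      using that by (simp add: f_def max_absorb2)
    then show "\<forall>\<^sub>F n in sequentially. eps (max t0 (2 ^ n)) = 2 ^ n * f (2 ^ n)"
      by (auto simp: eventually_sequentially)
  qed
  also have "\<dots> \<longleftrightarrow> summable f" using fm f0 by (intro condensation_test[symmetric]) auto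
  also have "\<dots> \<longleftrightarrow> convergent (\<lambda>n. \<Sum>k\<le>n. f k)" by (rule summable_iff_convergent')
  also have "\<dots> \<longleftrightarrow> convergent (\<lambda>n. (\<Sum>k<k0. f k) + (\<Sum>k = k0..n. 1 / real k - \<psi> (real k)))"
  proof (rule convergent_cong)
    have "(\<Sum>k\<le>n. f k) = (\<Sum>k<k0. f k) + (\<Sum>k = k0..n. 1 / real k - \<psi> (real k))" if "n \<ge> k0" for n
    proof -
      have "{..n} = {..<k0} \<union> {k0..n}" using that by auto
      then have "(\<Sum>k\<le>n. f k) = (\<Sum>k<k0. f k) + (\<Sum>k = k0..n. f k)"
        by (simp only:) (rule sum.union_disjoint, auto)
      then show ?thesis using feq by simp
    qed
    then show "\<forall>\<^sub>F n in sequentially. (\<Sum>k\<le>n. f k) = (\<Sum>k<k0. f k) + (\<Sum>k = k0..n. 1 / real k - \<psi> (real k))"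
      by (auto simp: eventually_sequentially)
  qed
  also have "\<dots> \<longleftrightarrow> convergent (\<lambda>n. \<Sum>k = k0..n. 1 / real k - \<psi> (real k))"
    by (rule convergent_add_const_iff)
  finally show ?thesis by (simp only: k0_def)
qed

text \<open>If \<open>\<alpha>\<close> is within \<open>r n\<close> of the real part
  \<open>x\<close> of a hexagonal point, it is sparse at the time \<open>t\<close> whose height is
  that of the point, and \<open>t\<close> grows with \<open>n\<close>. So a member of
  \<open>D2 \<psi>\<close> meets such balls at only finitely many scales.\<close>

lemma D2_negligible:
  assumes div: "\<not> summable (\<lambda>n. eps (max t0 (2 ^ n)))"
  shows "negligible (D2 \<psi>)"
proof -
  \<comment> \<open>The shift by 4 makes \<open>2^(n + 4)\<close> an upper bound for the times used:
    \<open>t^2 Y \<le> 1\<close> and \<open>Y \<ge> 1/(256 * 4^n)\<close> give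
    \<open>t \<le> 16 * 2^n\<close>.\<close>
  define e where "e n = eps (max t0 (2 ^ (n + 4)))" for n
  have "\<exists>x Y. \<forall>p q. coprime p q \<longrightarrow> q > 0 \<longrightarrow> \<bar>x p q - p / q\<bar> \<le> 1 / real_of_int q ^ 2 \<and>
     1 / (4 * real_of_int q ^ 2) \<le> Y p q \<and> Y p q \<le> 1 / real_of_int q ^ 2 \<and>
    (\<forall>(p' :: int) (q' :: int). p' \<noteq> 0 \<or> q' \<noteq> 0 \<longrightarrow>
      (real_of_int q' * x p q - real_of_int p')\<^sup>2 + (real_of_int q' * Y p q)\<^sup>2 \<ge> 2 / sqrt 3 * Y p q)"
  proof -
    have "\<forall>p q. \<exists>x Y. coprime p q \<longrightarrow> q > 0 \<longrightarrow> \<bar>x - p / q\<bar> \<le> 1 / real_of_int q ^ 2 \<and>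
     1 / (4 * real_of_int q ^ 2) \<le> Y \<and> Y \<le> 1 / real_of_int q ^ 2 \<and>
    (\<forall>(p' :: int) (q' :: int). p' \<noteq> 0 \<or> q' \<noteq> 0 \<longrightarrow>
      (real_of_int q' * x - real_of_int p')\<^sup>2 + (real_of_int q' * Y)\<^sup>2 \<ge> 2 / sqrt 3 * Y)"
      using hexagonal_point_near_fraction by simp
    then show ?thesis unfolding choice_iff .
  qed
  then obtain x Y where xY0: "\<forall>p q. coprime p q \<longrightarrow> q > 0 \<longrightarrow> \<bar>x p q - p / q\<bar> \<le> 1 / real_of_int q ^ 2 \<and>
     1 / (4 * real_of_int q ^ 2) \<le> Y p q \<and> Y p q \<le> 1 / real_of_int q ^ 2 \<and>
    (\<forall>(p' :: int) (q' :: int). p' \<noteq> 0 \<or> q' \<noteq> 0 \<longrightarrow>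
      (real_of_int q' * x p q - real_of_int p')\<^sup>2 + (real_of_int q' * Y p q)\<^sup>2 \<ge> 2 / sqrt 3 * Y p q)"
    by (elim exE) (rule that)
  have xY: "\<bar>x p q - p / q\<bar> \<le> 1 / real_of_int q ^ 2" "1 / (4 * real_of_int q ^ 2) \<le> Y p q"
     "Y p q \<le> 1 / real_of_int q ^ 2"
     "\<And>p' q'. p' \<noteq> 0 \<or> q' \<noteq> 0 \<Longrightarrow>
      (real_of_int q' * x p q - real_of_int p')\<^sup>2 + (real_of_int q' * Y p q)\<^sup>2 \<ge> 2 / sqrt 3 * Y p q"
     if "coprime p q" "q > 0" for p q
    using xY0[rule_format, OF that] by auto
  interpret shifted_fractions e "\<lambda>(p, q). x p q"
  proof
    show "0 \<le> e n" "e n \<le> 1" for n using eps_bounds[of "max t0 (2 ^ (n + 4))"] by (auto simp: e_def)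
    show "\<not> summable e" using div summable_iff_shift[of "\<lambda>n. eps (max t0 (2 ^ n))" 4]
      by (simp add: e_def[abs_def])
    show "\<bar>(case (p, q) of (p, q) \<Rightarrow> x p q) - p / q\<bar> \<le> 1 / real_of_int q ^ 2" if "coprime p q" "q > 0" for p q
      using xY(1)[OF that] by simp
  qed
  have "\<forall>\<^sub>F n in sequentially. \<forall>v\<in>fracs n. \<alpha> \<notin> ball (case v of (p, q) \<Rightarrow> x p q) (r n)" if \<alpha>D: "\<alpha> \<in> D2 \<psi>" for \<alpha>
  proof -
    obtain T where T: "\<And>t. t \<ge> max t0 T \<Longrightarrow> \<not> sparse \<alpha> t"
      using \<alpha>D notin_D2_iff[of \<alpha>] by blast
    \<comment> \<open>A lower bound for \<open>t * \<psi> t\<close>. With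
      \<open>Y \<le> 1/4^n\<close> it yields \<open>t^2 \<ge> \<kappa> * 4^n\<close>, so the times
      tend to infinity.\<close>
    define \<kappa> where "\<kappa> = t0 * \<psi> t0"
    have \<kappa>: "\<kappa> > 0" using t0 \<psi>_pos[of t0] by (simp add: \<kappa>_def)
    have "\<forall>\<^sub>F n in sequentially. (max t0 T)\<^sup>2 / \<kappa> \<le> 4 ^ n"
      "\<forall>\<^sub>F n in sequentially. t0 / \<psi> t0 \<le> 4 ^ n"
      "\<forall>\<^sub>F n in sequentially. t0 \<le> 2 ^ n"
      by (simp_all add: eventually_le_power)
    then show ?thesis
    proof eventually_elim
      case (elim n)
      show ?case
      proof (intro ballI notI)
        fix v assume v: "v \<in> fracs n" "\<alpha> \<in> ball (case v of (p, q) \<Rightarrow> x p q) (r n)"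
        obtain p q where pq: "(p, q) \<in> fracs n" and "\<alpha> \<in> ball (x p q) (r n)"
          using v by (cases v) auto
        then have \<alpha>: "\<bar>\<alpha> - x p q\<bar> < r n" by (simp add: dist_real_def abs_minus_commute)
        note f = fracsD[OF pq] and g = xY[OF fracsD(1,2)[OF pq]]
        have q2: "0 < real_of_int q ^ 2" "4 ^ n \<le> real_of_int q ^ 2" "real_of_int q ^ 2 \<le> 64 * 4 ^ n"
        proof -
          show "0 < real_of_int q ^ 2" using f(2) by simp
          then show "4 ^ n \<le> real_of_int q ^ 2" using f(5) by (simp add: field_simps)
          have "real_of_int q ^ 2 \<le> (8 * 2 ^ n)\<^sup>2" using f(2,4) by (intro power_mono) auto
          then show "real_of_int q ^ 2 \<le> 64 * 4 ^ n" by (simp add: power2_eq_square power_mult_distrib[symmetric])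
        qed
        define y where "y = Y p q"
        have y: "1 / (256 * 4 ^ n) \<le> y" "y \<le> 1 / 4 ^ n"
        proof -
          have "1 / (256 * 4 ^ n) \<le> 1 / (4 * real_of_int q ^ 2)"
            using q2 by (intro divide_left_mono) auto
          with g(2) show "1 / (256 * 4 ^ n) \<le> y" by (simp add: y_def)
          show "y \<le> 1 / 4 ^ n" using g(3) f(5) by (simp add: y_def)
        qed
        have ypos: "0 < y" by (rule less_le_trans[OF _ y(1)]) simp
        have "1 / 4 ^ n \<le> \<psi> t0 / t0" using elim(2) t0 \<psi>_pos[of t0] by (simp add: field_simps)
        with y obtain t where t: "t \<ge> t0" "\<psi> t / t = y" using ex_height[OF ypos] by auto
        have tp: "t > 0" using t t0 by simp
        have t2: "t\<^sup>2 * y = 1 - eps t" using t tp by (auto simp: eps_def power2_eq_square)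
        have "t\<^sup>2 * y \<le> 1" unfolding t2 using eps_bounds[OF t(1)] by simp
        also have "1 \<le> (256 * 4 ^ n) * y" using y(1) by (simp add: field_simps)
        finally have "t\<^sup>2 \<le> 256 * 4 ^ n" using ypos by simp
        also have "(256 * 4 ^ n :: real) = (2 ^ (n + 4))\<^sup>2" by (simp add: power_add power2_eq_square power_mult_distrib[symmetric])
        finally have tle: "t \<le> 2 ^ (n + 4)" by (rule power2_le_imp_le) simp
        have tge: "max t0 T \<le> t"
        proof -
          have "\<kappa> \<le> t * \<psi> t" using mono_onD[OF \<psi>_mono, of t0 t] t by (simp add: \<kappa>_def)
          also have "\<dots> = t\<^sup>2 * y" using t tp by (auto simp: power2_eq_square)
          also have "\<dots> \<le> t\<^sup>2 * (1 / 4 ^ n)" using y by (intro mult_left_mono) auto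
          finally have "\<kappa> * 4 ^ n \<le> t\<^sup>2" by (simp add: field_simps)
          moreover have "(max t0 T)\<^sup>2 \<le> \<kappa> * 4 ^ n" using elim(1) \<kappa> by (simp add: field_simps)
          ultimately have "(max t0 T)\<^sup>2 \<le> t\<^sup>2" by linarith
          then show ?thesis by (rule power2_le_imp_le) (use tp in simp)
        qed
        have "(2 :: real) ^ n \<le> 2 ^ (n + 4)" by (intro power_increasing) auto
        then have m: "max t0 (2 ^ (n + 4)) = 2 ^ (n + 4)" using elim(3) by linarith
        have "r n = eps (2 ^ (n + 4)) * (1 / (256 * 4 ^ n))" unfolding r_def e_def m by simp
        also have "\<dots> \<le> eps t * y"
          using eps_antimono[OF t(1) tle] y eps_bounds[OF t(1)] by (intro mult_mono) auto
        finally have close: "\<bar>\<alpha> - x p q\<bar> \<le> eps t * y" using \<alpha> by linarith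
        have "sparse \<alpha> t"
          unfolding sparse_def t(2)
          by (intro allI impI form_shift_ge[OF ypos g(4)[folded y_def] close])
            (use eps_bounds[OF t(1)] in auto)
        with T[OF tge] show False by simp
      qed
    qed
  qed
  then show ?thesis
    by (intro negligible_subset[OF negligible_finitely_often]) auto
qed

end

section \<open>The convergent case\<close>

text \<open>Only finitely many vectors have value at most 1, and \<open>(1, 0)\<close> is one of
  them, so a minimum over these is a global one.\<close>

lemma ex_minimal_vector:
  fixes \<alpha> y :: real
  assumes y: "y > 0"
  defines "f \<equiv> \<lambda>(p :: int) (q :: int). (\<alpha> * real_of_int q - real_of_int p)\<^sup>2 + (real_of_int q * y)\<^sup>2"
  shows "\<exists>p q. (p \<noteq> 0 \<or> q \<noteq> 0) \<and> (\<forall>p' q'. p' \<noteq> 0 \<or> q' \<noteq> 0 \<longrightarrow> f p q \<le> f p' q')"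
proof -
  define S where "S = {v. (fst v \<noteq> 0 \<or> snd v \<noteq> 0) \<and> f (fst v) (snd v) \<le> 1}"
  define L where "L = \<lceil>1 / y\<rceil>"
  define K where "K = \<lceil>\<bar>\<alpha>\<bar> * L\<rceil> + 1"
  have "S \<subseteq> {-K..K} \<times> {-L..L}"
  proof
    fix v assume v: "v \<in> S"
    obtain p q where pq: "v = (p, q)" by (cases v)
    have f: "(\<alpha> * real_of_int q - real_of_int p)\<^sup>2 + (real_of_int q * y)\<^sup>2 \<le> 1"
      using v by (simp add: S_def pq f_def)
    have "(real_of_int q * y)\<^sup>2 \<le> 1" "(\<alpha> * real_of_int q - real_of_int p)\<^sup>2 \<le> 1"
      using f zero_le_power2[of "\<alpha> * real_of_int q - real_of_int p"] zero_le_power2[of "real_of_int q * y"] by linarith+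
    then have 1: "\<bar>real_of_int q * y\<bar> \<le> 1" "\<bar>\<alpha> * real_of_int q - real_of_int p\<bar> \<le> 1"
      by (simp_all only: abs_square_le_1)
    have "\<bar>real_of_int q\<bar> \<le> 1 / y" using 1(1) y by (simp add: abs_mult field_simps)
    then have q: "\<bar>real_of_int q\<bar> \<le> L" unfolding L_def by linarith
    have "\<bar>\<alpha> * real_of_int q\<bar> \<le> \<bar>\<alpha>\<bar> * L" unfolding abs_mult using q by (intro mult_left_mono) auto
    then have "\<bar>real_of_int p\<bar> \<le> K" using 1(2) unfolding K_def by linarith
    then show "v \<in> {-K..K} \<times> {-L..L}" using q by (auto simp: pq)
  qed
  then have fin: "finite S" by (rule finite_subset) auto
  have ne: "(1, 0) \<in> S" by (simp add: S_def f_def)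
  define v where "v = arg_min_on (\<lambda>v. f (fst v) (snd v)) S"
  have v: "v \<in> S" "\<And>w. w \<in> S \<Longrightarrow> f (fst v) (snd v) \<le> f (fst w) (snd w)"
    using arg_min_if_finite[of S "\<lambda>v. f (fst v) (snd v)"] fin ne unfolding v_def
    by (auto simp: not_less)
  have "f (fst v) (snd v) \<le> f p' q'" if "p' \<noteq> 0 \<or> q' \<noteq> 0" for p' q'
  proof (cases "f p' q' \<le> 1")
    case True
    then show ?thesis using v(2)[of "(p', q')"] that by (simp add: S_def)
  next
    case False
    then show ?thesis using v(1) by (simp add: S_def)
  qed
  then show ?thesis using v(1) by (auto simp: S_def)
qed

text \<open>Lagrange-Gauss reduction: a minimal vector is primitive, Bezout's identity completes it
  to a basis, and subtracting a multiple of it from the second vector makes the inner product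
  small.\<close>

lemma ex_reduced_basis:
  fixes \<alpha> y :: real
  assumes y: "y > 0"
  defines "f \<equiv> \<lambda>(p :: int) (q :: int). (\<alpha> * real_of_int q - real_of_int p)\<^sup>2 + (real_of_int q * y)\<^sup>2"
    and "b \<equiv> \<lambda>(p1 :: int) (q1 :: int) (p2 :: int) (q2 :: int).
      (\<alpha> * real_of_int q1 - real_of_int p1) * (\<alpha> * real_of_int q2 - real_of_int p2) +
      real_of_int q1 * real_of_int q2 * y\<^sup>2"
  shows "\<exists>p1 q1 p2 q2. \<bar>p1 * q2 - p2 * q1\<bar> = 1 \<and> f p1 q1 \<le> f p2 q2 \<and>
    0 \<le> b p1 q1 p2 q2 \<and> 2 * b p1 q1 p2 q2 \<le> f p1 q1"
proof -
  obtain p1 q1 where ne: "p1 \<noteq> 0 \<or> q1 \<noteq> 0" and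
    min: "\<And>p' q'. p' \<noteq> 0 \<or> q' \<noteq> 0 \<Longrightarrow> f p1 q1 \<le> f p' q'"
    using ex_minimal_vector[OF y, of \<alpha>] unfolding f_def by blast
  have fpos: "0 < f p q" if "p \<noteq> 0 \<or> q \<noteq> 0" for p q
    unfolding f_def using that y by (cases "q = 0") (auto intro: add_nonneg_pos)
  define g where "g = gcd p1 q1"
  have "g > 0" using ne by (auto simp: g_def)
  obtain p' q' where g: "p1 = g * p'" "q1 = g * q'" unfolding g_def by (meson dvdE gcd_dvd1 gcd_dvd2)
  have ne': "p' \<noteq> 0 \<or> q' \<noteq> 0" using ne g by auto
  have "f p1 q1 = real_of_int g ^ 2 * f p' q'"
    unfolding f_def g by (simp add: power2_eq_square algebra_simps)
  \<comment> \<open>Minimality excludes a proper common divisor, since dividing by \<open>g\<close>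
    divides the form by \<open>g^2\<close>.\<close>
  then have "real_of_int g ^ 2 * f p' q' \<le> 1 * f p' q'" using min[OF ne'] by simp
  then have "real_of_int g ^ 2 \<le> 1" using fpos[OF ne'] by (simp only: mult_le_cancel_right_pos)
  then have "g = 1" using \<open>g > 0\<close> by (simp add: abs_square_le_1)
  then obtain u v where uv: "u * p1 + v * q1 = 1"
    using bezout_int[of p1 q1] by (auto simp: g_def)
  define A where "A = f p1 q1"
  have A: "A > 0" unfolding A_def by (rule fpos[OF ne])
  define k where "k = round (b p1 q1 (- v) u / A)"
  define p2 q2 where "p2 = - v - k * p1" and "q2 = u - k * q1"
  have det: "p1 * q2 - p2 * q1 = 1" using uv by (simp add: p2_def q2_def algebra_simps)
  have ne2: "p2 \<noteq> 0 \<or> q2 \<noteq> 0" using det by auto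
  have "b p1 q1 p2 q2 = b p1 q1 (- v) u - k * A"
    unfolding b_def A_def f_def p2_def q2_def by (simp add: power2_eq_square algebra_simps)
  then have "b p1 q1 p2 q2 / A = b p1 q1 (- v) u / A - k" using A by (simp add: field_simps)
  moreover have "\<bar>k - b p1 q1 (- v) u / A\<bar> \<le> 1 / 2"
    unfolding k_def using of_int_round_abs_le by (metis)
  ultimately have "\<bar>b p1 q1 p2 q2 / A\<bar> \<le> 1 / 2" by linarith
  then have B: "2 * \<bar>b p1 q1 p2 q2\<bar> \<le> A" using A by (simp add: abs_divide field_simps)
  show ?thesis
  proof (cases "b p1 q1 p2 q2 \<ge> 0")
    case True
    then show ?thesis using det B min[OF ne2]
      by (intro exI[of _ p1] exI[of _ q1] exI[of _ p2] exI[of _ q2]) (auto simp: A_def)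
  next
    case False
    \<comment> \<open>Negating the second vector makes the inner product nonnegative at the cost of
      the sign of the determinant, whence the absolute value in the conclusion.\<close>
    have "b p1 q1 (- p2) (- q2) = - b p1 q1 p2 q2" unfolding b_def by (simp add: algebra_simps)
    moreover have "p1 * (- q2) - (- p2) * q1 = - 1" using det by simp
    moreover have "f p1 q1 \<le> f (- p2) (- q2)" using ne2 by (intro min) auto
    ultimately show ?thesis using B False
      by (intro exI[of _ p1] exI[of _ q1] exI[of _ "- p2"] exI[of _ "- q2"]) (auto simp: A_def)
  qed
qed

text \<open>Quantitative stability of the hexagonal lattice as the minimiser of the determinant
  \<open>AC - B\<^sup>2\<close> among reduced forms of given minimum \<open>A\<close>.\<close>
lemma near_hexagonal:
  fixes x1 x2 q1 q2 y e s :: real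
  defines "A \<equiv> x1\<^sup>2 + (q1 * y)\<^sup>2" and "C \<equiv> x2\<^sup>2 + (q2 * y)\<^sup>2" and "B \<equiv> x1 * x2 + q1 * q2 * y\<^sup>2"
  assumes y: "y > 0" and e: "0 \<le> e" "e \<le> 1 / 2"
    and det: "\<bar>x1 * q2 - x2 * q1\<bar> = 1"
    and A: "2 / sqrt 3 * y * (1 - e) \<le> A" and AC: "A \<le> C" and B: "0 \<le> B" "2 * B \<le> A"
    and s: "s = max \<bar>q1\<bar> \<bar>q2\<bar>"
  shows "\<bar>x1 * (2 * q1 - q2) + x2 * (2 * q2 - q1)\<bar> \<le> 640 * e" "1 \<le> 30 * y * s\<^sup>2" "s\<^sup>2 * y \<le> 10"
proof -
  have det2: "(x1 * q2 - x2 * q1)\<^sup>2 = 1" using det by (metis power2_abs one_power2)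
  have disc: "A * C - B\<^sup>2 = y\<^sup>2"
  proof -
    have "A * C - B\<^sup>2 = y\<^sup>2 * (x1 * q2 - x2 * q1)\<^sup>2"
      unfolding A_def B_def C_def by (simp add: power2_eq_square algebra_simps)
    then show ?thesis using det2 by simp
  qed
  have s3: "sqrt 3 * sqrt 3 = (3 :: real)" "sqrt (3 :: real) \<le> 2"
    by (simp, rule real_le_lsqrt, auto)
  have Ay: "y / 2 \<le> A"
  proof -
    have "1 * y * (1 / 2) \<le> 2 / sqrt 3 * y * (1 - e)"
      using s3 y e by (intro mult_mono) (auto simp: field_simps)
    then show ?thesis using A by simp
  qed
  have Apos: "A > 0" using Ay y by linarith
  have A2: "y\<^sup>2 * (1 - 2 * e) \<le> 3 / 4 * A\<^sup>2"
  proof -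
    have "(2 / sqrt 3 * y * (1 - e))\<^sup>2 \<le> A\<^sup>2" using A y e by (intro power_mono) auto
    then have "4 / 3 * (y\<^sup>2 * (1 - e)\<^sup>2) \<le> A\<^sup>2" by (simp add: power_mult_distrib power_divide)
    moreover have "y\<^sup>2 * (1 - 2 * e) \<le> y\<^sup>2 * (1 - e)\<^sup>2"
      by (intro mult_left_mono) (auto simp: power2_eq_square algebra_simps)
    ultimately show ?thesis by linarith
  qed
  \<comment> \<open>\<open>gap\<close> measures the deviation from the hexagonal form, for which
    \<open>C = A = 2 B\<close>.\<close>
  define gap where "gap = (C - A) + (A - 2 * B)"
  have gap0: "0 \<le> C - A" "0 \<le> A - 2 * B" using AC B by auto
  have "A / 4 * gap \<le> y\<^sup>2 - 3 / 4 * A\<^sup>2"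
  proof -
    \<comment> \<open>The determinant exceeds its minimum \<open>3/4 A^2\<close> by an amount
      controlling both defects, while the lower bound on \<open>A\<close> allows an excess of at
      most \<open>2 e y^2\<close>.\<close>
    have "y\<^sup>2 - 3 / 4 * A\<^sup>2 = A * (C - A) + (A / 2 - B) * (A / 2 + B)"
      unfolding disc[symmetric] by (simp add: power2_eq_square algebra_simps)
    moreover have "A / 4 * (C - A) \<le> A * (C - A)" using gap0 Apos by (intro mult_right_mono) auto
    moreover have "(A / 2 - B) * (A / 2) \<le> (A / 2 - B) * (A / 2 + B)" using gap0 B by (intro mult_left_mono) auto
    moreover have "A / 4 * gap = A / 4 * (C - A) + (A / 2 - B) * (A / 2)"
      unfolding gap_def by (simp add: field_simps)
    ultimately show ?thesis by linarith
  qed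
  also have "\<dots> \<le> 2 * e * y\<^sup>2" using A2 by (simp add: algebra_simps)
  finally have "A * gap \<le> 8 * e * y\<^sup>2" by simp
  moreover have "y / 2 * gap \<le> A * gap" using Ay gap0 by (intro mult_right_mono) (auto simp: gap_def)
  ultimately have "y * gap \<le> y * (16 * e * y)" by (simp add: power2_eq_square algebra_simps)
  then have gap: "gap \<le> 16 * e * y" using y by simp
  have "3 / 4 * A\<^sup>2 \<le> y\<^sup>2"
  proof -
    have "0 \<le> A / 4 * gap" using Apos gap0 by (simp add: gap_def)
    with \<open>A / 4 * gap \<le> y\<^sup>2 - 3 / 4 * A\<^sup>2\<close> show ?thesis by linarith
  qed
  have "A\<^sup>2 \<le> (2 * y)\<^sup>2" 
  proof -
    have "(2 * y)\<^sup>2 = 4 * y\<^sup>2" by (simp add: power_mult_distrib)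
    then show ?thesis using \<open>3 / 4 * A\<^sup>2 \<le> y\<^sup>2\<close> zero_le_power2[of A] by linarith
  qed
  then have "A \<le> 2 * y" by (rule power2_le_imp_le) (use y in simp)
  moreover have "16 * e * y \<le> 8 * y" using e y by (intro mult_right_mono) auto
  ultimately have Cy: "C \<le> 10 * y" using gap gap0 unfolding gap_def by linarith
  have qs: "(q * y)\<^sup>2 \<le> C" if "q \<in> {q1, q2}" for q
    using that AC unfolding A_def C_def by (auto intro: order_trans[rotated])
  have xs: "x\<^sup>2 \<le> C" if "x \<in> {x1, x2}" for x
    using that AC unfolding A_def C_def by (auto intro: order_trans[rotated])
  have xq: "\<bar>x * q\<bar> \<le> 10" if "x \<in> {x1, x2}" "q \<in> {q1, q2}" for x q
  proof -
    have "(x * (q * y))\<^sup>2 \<le> (10 * y)\<^sup>2"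
      unfolding power_mult_distrib[of x] power2_eq_square[of "10 * y"] using xs[OF that(1)] qs[OF that(2)] Cy y
      by (intro mult_mono) auto
    then have "\<bar>x * (q * y)\<bar> \<le> \<bar>10 * y\<bar>" by (simp only: abs_le_square_iff)
    then have "\<bar>x * q\<bar> * y \<le> 10 * y" using y by (simp add: abs_mult)
    then show ?thesis using y by simp
  qed
  \<comment> \<open>The vectors \<open>(x1, x2)\<close> and \<open>(q1, q2)\<close> are orthogonal
    for the adjugate of the Gram matrix. If \<open>C = A = 2 B\<close>, the left side is
    \<open>A / 2 * w\<close>, so \<open>w\<close> is bounded by the defects.\<close>
  have orth: "C * (x1 * q1) - B * (x1 * q2 + x2 * q1) + A * (x2 * q2) = 0"
    unfolding A_def B_def C_def by (simp add: power2_eq_square algebra_simps)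
  define w where "w = x1 * (2 * q1 - q2) + x2 * (2 * q2 - q1)"
  have "A / 2 * w = - ((C - A) * (x1 * q1) + (A / 2 - B) * (x1 * q2 + x2 * q1))"
    using orth unfolding w_def by (simp add: algebra_simps)
  then have "\<bar>A / 2 * w\<bar> = \<bar>(C - A) * (x1 * q1) + (A / 2 - B) * (x1 * q2 + x2 * q1)\<bar>" by (simp only: abs_minus_cancel)
  also have "\<dots> \<le> (C - A) * 10 + (A / 2 - B) * 20"
  proof -
    have "\<bar>(C - A) * (x1 * q1)\<bar> \<le> (C - A) * 10"
      unfolding abs_mult[of "C - A"] using gap0 xq[of x1 q1] by (intro mult_mono) auto
    moreover have "\<bar>(A / 2 - B) * (x1 * q2 + x2 * q1)\<bar> \<le> (A / 2 - B) * 20"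
      unfolding abs_mult[of "A / 2 - B"] using gap0 xq[of x1 q2] xq[of x2 q1] by (intro mult_mono) auto
    ultimately show ?thesis by linarith
  qed
  also have "\<dots> = 10 * gap" unfolding gap_def by simp
  also have "\<dots> \<le> 160 * e * y" using gap by simp
  finally have "\<bar>A / 2 * w\<bar> \<le> 160 * e * y" .
  then have "A / 2 * \<bar>w\<bar> \<le> 160 * e * y" using Apos by (simp add: abs_mult)
  moreover have "y / 4 * \<bar>w\<bar> \<le> A / 2 * \<bar>w\<bar>" using Ay by (intro mult_right_mono) auto
  ultimately have "y * \<bar>w\<bar> \<le> y * (640 * e)" by (simp add: algebra_simps)
  then show "\<bar>x1 * (2 * q1 - q2) + x2 * (2 * q2 - q1)\<bar> \<le> 640 * e" using y by (simp add: w_def)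
  have sq: "s \<in> {\<bar>q1\<bar>, \<bar>q2\<bar>}" "\<bar>q1\<bar> \<le> s" "\<bar>q2\<bar> \<le> s" "0 \<le> s" using s by (auto simp: max_def)
  have "(s * y)\<^sup>2 \<le> 10 * y" using qs[of q1] qs[of q2] Cy sq(1) by (auto simp: power_mult_distrib)
  then have "y * (s\<^sup>2 * y) \<le> y * 10" by (simp add: power2_eq_square algebra_simps)
  then show "s\<^sup>2 * y \<le> 10" using y by simp
  \<comment> \<open>The adjugate form at \<open>(q1, q2)\<close> is the squared determinant; this
    bounds \<open>s\<close> from below.\<close>
  have "1 = C * q1\<^sup>2 - 2 * B * (q1 * q2) + A * q2\<^sup>2"
    unfolding det2[symmetric] A_def B_def C_def by (simp add: power2_eq_square algebra_simps)
  also have "\<dots> \<le> C * s\<^sup>2 + A * s\<^sup>2 + A * s\<^sup>2"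
  proof -
    have "q1\<^sup>2 \<le> s\<^sup>2" "q2\<^sup>2 \<le> s\<^sup>2" using sq by (auto simp: abs_le_square_iff[symmetric])
    then have "C * q1\<^sup>2 \<le> C * s\<^sup>2" "A * q2\<^sup>2 \<le> A * s\<^sup>2"
      using Apos AC by (auto intro!: mult_left_mono)
    moreover have "- (2 * B * (q1 * q2)) \<le> A * s\<^sup>2"
    proof -
      have "- (2 * B * (q1 * q2)) \<le> \<bar>2 * B * (q1 * q2)\<bar>" by simp
      also have "\<dots> = 2 * B * (\<bar>q1\<bar> * \<bar>q2\<bar>)" using B by (simp add: abs_mult)
      also have "\<dots> \<le> A * (s * s)" using B sq Apos by (intro mult_mono) auto
      finally show ?thesis by (simp add: power2_eq_square)
    qed
    ultimately show ?thesis by linarith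
  qed
  also have "\<dots> = (C + A + A) * s\<^sup>2" by (simp add: algebra_simps)
  also have "\<dots> \<le> (30 * y) * s\<^sup>2" using AC Cy by (intro mult_right_mono) auto
  finally show "1 \<le> 30 * y * s\<^sup>2" .
qed

text \<open>The real part of the orbit point at which \<open>(p1, q1)\<close>, \<open>(p2, q2)\<close> become a basis of a hexagonal
  lattice with angle \<open>\<pi>/3\<close>.\<close>
definition hex_centre :: "int \<Rightarrow> int \<Rightarrow> int \<Rightarrow> int \<Rightarrow> real" where
  "hex_centre p1 q1 p2 q2 =
     real_of_int (2 * p1 * q1 + 2 * p2 * q2 - p1 * q2 - p2 * q1) / real_of_int (2 * (q1\<^sup>2 - q1 * q2 + q2\<^sup>2))"

lemma hex_centre_swap: "hex_centre p2 q2 p1 q1 = hex_centre p1 q1 p2 q2"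
  by (simp add: hex_centre_def algebra_simps)

text \<open>For fixed \<open>(q1, q2)\<close> the solutions \<open>(p1, p2)\<close> differ by
  integer multiples of \<open>(q1, q2)\<close>, which translate the centre by integers. Hence there
  is at most one centre modulo 1 for each pair of denominators, which makes the centres countable by
  scale.\<close>

lemma hex_centre_mod_1:
  "\<exists>\<beta>. 0 \<le> \<beta> \<and> \<beta> < 1 \<and> (\<forall>p1 p2. p1 * q2 - p2 * q1 = 1 \<longrightarrow> (\<exists>k :: int. hex_centre p1 q1 p2 q2 = \<beta> + real_of_int k))"
proof (cases "\<exists>p1 p2. p1 * q2 - p2 * q1 = 1")
  case False
  \<comment> \<open>Without a solution the condition is vacuous and 0 is a default value.\<close>
  then show ?thesis by (intro exI[of _ 0]) auto
next
  case True
  then obtain a1 a2 where a: "a1 * q2 - a2 * q1 = 1" by auto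
  define c where "c = hex_centre a1 q1 a2 q2"
  have "\<exists>k :: int. hex_centre p1 q1 p2 q2 = frac c + real_of_int k" if p: "p1 * q2 - p2 * q1 = 1" for p1 p2
  proof -
    define k where "k = p1 * a2 - p2 * a1"
    have "p1 * (a1 * q2 - a2 * q1) - a1 * (p1 * q2 - p2 * q1) = - (q1 * k)"
      "p2 * (a1 * q2 - a2 * q1) - a2 * (p1 * q2 - p2 * q1) = - (q2 * k)"
      unfolding k_def by (simp_all add: algebra_simps)
    then have p12: "p1 = a1 - q1 * k" "p2 = a2 - q2 * k" unfolding a p by simp_all
    define Q where "Q = real_of_int (q1\<^sup>2 - q1 * q2 + q2\<^sup>2)"
    have "(q1, - q2) \<noteq> (0, 0)" using a by auto
    then have "q1\<^sup>2 - q1 * q2 + q2\<^sup>2 \<noteq> 0" using eisenstein_form_pos[of q1 "- q2"] by simp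
    then have "Q \<noteq> 0" unfolding Q_def by (simp only: of_int_eq_0_iff not_False_eq_True)
    have "real_of_int (2 * p1 * q1 + 2 * p2 * q2 - p1 * q2 - p2 * q1) =
        real_of_int (2 * a1 * q1 + 2 * a2 * q2 - a1 * q2 - a2 * q1) - k * (2 * Q)"
      unfolding p12 Q_def by (simp add: power2_eq_square algebra_simps)
    then have "hex_centre p1 q1 p2 q2 = c - k"
      using \<open>Q \<noteq> 0\<close> unfolding c_def hex_centre_def of_int_mult[of 2] Q_def[symmetric] of_int_numeral
      by (simp add: diff_divide_distrib)
    also have "\<dots> = frac c + real_of_int (\<lfloor>c\<rfloor> - k)" by (simp add: frac_def)
    finally show ?thesis by blast
  qed
  then show ?thesis by (intro exI[of _ "frac c"]) (auto simp: frac_lt_1)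
qed

section \<open>Covering the complement by intervals around hexagonal centres\<close>

context approx_function
begin

text \<open>Sparseness bounds the minimum of a reduced basis from below, so the basis is nearly
  hexagonal by \<open>near_hexagonal\<close>. As \<open>t^2 y\<close> lies between 1/2 and 1, the
  bounds relating \<open>s\<close> to \<open>y\<close> become bounds relating \<open>s\<close> to
  \<open>t\<close>.\<close>

lemma near_hex_centre:
  assumes t: "t \<ge> t0" and e: "eps t \<le> 1 / 2" and sp: "sparse \<alpha> t"
  shows "\<exists>p1 q1 p2 q2. p1 * q2 - p2 * q1 = 1 \<and>
    \<bar>\<alpha> - hex_centre p1 q1 p2 q2\<bar> * real_of_int (max \<bar>q1\<bar> \<bar>q2\<bar>) ^ 2 \<le> 500 * eps t \<and>
    t\<^sup>2 \<le> 30 * real_of_int (max \<bar>q1\<bar> \<bar>q2\<bar>) ^ 2 \<and> real_of_int (max \<bar>q1\<bar> \<bar>q2\<bar>) ^ 2 \<le> 20 * t\<^sup>2"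
proof -
  have tpos: "t > 0" "\<psi> t > 0" using t t0 \<psi>_pos by auto
  define y where "y = \<psi> t / t"
  have y: "y > 0" using tpos by (simp add: y_def)
  have ty: "t\<^sup>2 * y = 1 - eps t" using tpos by (simp add: y_def eps_def power2_eq_square)
  obtain p1 q1 p2 q2 where det: "\<bar>p1 * q2 - p2 * q1\<bar> = 1"
    and red: "(\<alpha> * real_of_int q1 - real_of_int p1)\<^sup>2 + (real_of_int q1 * y)\<^sup>2
        \<le> (\<alpha> * real_of_int q2 - real_of_int p2)\<^sup>2 + (real_of_int q2 * y)\<^sup>2"
      "0 \<le> (\<alpha> * real_of_int q1 - real_of_int p1) * (\<alpha> * real_of_int q2 - real_of_int p2) + real_of_int q1 * real_of_int q2 * y\<^sup>2"
      "2 * ((\<alpha> * real_of_int q1 - real_of_int p1) * (\<alpha> * real_of_int q2 - real_of_int p2) + real_of_int q1 * real_of_int q2 * y\<^sup>2)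
        \<le> (\<alpha> * real_of_int q1 - real_of_int p1)\<^sup>2 + (real_of_int q1 * y)\<^sup>2"
    using ex_reduced_basis[OF y, of \<alpha>] by (elim exE conjE) (rule that)
  define x1 x2 where "x1 = \<alpha> * real_of_int q1 - real_of_int p1" and "x2 = \<alpha> * real_of_int q2 - real_of_int p2"
  define s where "s = real_of_int (max \<bar>q1\<bar> \<bar>q2\<bar>)"
  have ne: "p1 \<noteq> 0 \<or> q1 \<noteq> 0" using det by auto
  have "x1 * real_of_int q2 - x2 * real_of_int q1 = - real_of_int (p1 * q2 - p2 * q1)"
    unfolding x1_def x2_def by (simp add: algebra_simps)
  then have detx: "\<bar>x1 * real_of_int q2 - x2 * real_of_int q1\<bar> = 1"
    using det by (metis abs_minus_cancel of_int_1 of_int_abs)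
  have A: "2 / sqrt 3 * y * (1 - eps t) \<le> x1\<^sup>2 + (real_of_int q1 * y)\<^sup>2"
    using sp ne unfolding sparse_def x1_def y_def by blast
  have s': "s = max \<bar>real_of_int q1\<bar> \<bar>real_of_int q2\<bar>" by (simp add: s_def of_int_max)
  note nh = near_hexagonal[OF y less_imp_le[OF eps_bounds(1)[OF t]] e detx A
      red(1)[folded x1_def x2_def] red(2)[folded x1_def x2_def] red(3)[folded x1_def x2_def] s']
  have s_t: "t\<^sup>2 \<le> 30 * s\<^sup>2" "s\<^sup>2 \<le> 20 * t\<^sup>2"
  proof -
    have "y * t\<^sup>2 \<le> 1" using ty eps_bounds[OF t] by (simp add: mult.commute)
    also have "1 \<le> y * (30 * s\<^sup>2)" using nh(2) by (simp add: mult_ac)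
    finally show "t\<^sup>2 \<le> 30 * s\<^sup>2" using y by simp
    have "y * s\<^sup>2 \<le> 10" using nh(3) by (simp add: mult.commute)
    also have "10 \<le> y * (20 * t\<^sup>2)" using ty e by (simp add: mult_ac)
    finally show "s\<^sup>2 \<le> 20 * t\<^sup>2" using y by simp
  qed
  define Q where "Q = real_of_int q1 ^ 2 - real_of_int q1 * real_of_int q2 + real_of_int q2 ^ 2"
  have Qs: "3 / 4 * s\<^sup>2 \<le> Q"
  proof -
    have "3 / 4 * real_of_int q1 ^ 2 \<le> Q"
      using zero_le_power2[of "real_of_int q2 - real_of_int q1 / 2"] unfolding Q_def by (simp add: power2_eq_square field_simps)
    moreover have "3 / 4 * real_of_int q2 ^ 2 \<le> Q"
      using zero_le_power2[of "real_of_int q1 - real_of_int q2 / 2"] unfolding Q_def by (simp add: power2_eq_square field_simps)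
    ultimately show ?thesis unfolding s' by (auto simp: max_def)
  qed
  have spos: "s\<^sup>2 > 0" using s_t(1) tpos by (smt (verit) zero_less_power)
  have Qpos: "Q > 0" using Qs spos by linarith
  \<comment> \<open>The numerator is the quantity \<open>near_hexagonal\<close> bounds by
    \<open>640 * eps t\<close>; its vanishing says that \<open>\<alpha>\<close> is the
    centre.\<close>
  have "\<alpha> - hex_centre p1 q1 p2 q2 =
    (x1 * (2 * real_of_int q1 - real_of_int q2) + x2 * (2 * real_of_int q2 - real_of_int q1)) / (2 * Q)"
  proof -
    have "hex_centre p1 q1 p2 q2 = real_of_int (2 * p1 * q1 + 2 * p2 * q2 - p1 * q2 - p2 * q1) / (2 * Q)"
      by (simp add: hex_centre_def Q_def)
    moreover have "\<alpha> * (2 * Q) - real_of_int (2 * p1 * q1 + 2 * p2 * q2 - p1 * q2 - p2 * q1) =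
      x1 * (2 * real_of_int q1 - real_of_int q2) + x2 * (2 * real_of_int q2 - real_of_int q1)"
      unfolding x1_def x2_def Q_def by (simp add: power2_eq_square algebra_simps)
    ultimately show ?thesis using Qpos by (simp add: field_simps)
  qed
  then have "\<bar>\<alpha> - hex_centre p1 q1 p2 q2\<bar> * (2 * Q) =
      \<bar>x1 * (2 * real_of_int q1 - real_of_int q2) + x2 * (2 * real_of_int q2 - real_of_int q1)\<bar>"
    using Qpos by (simp add: abs_divide)
  also have "\<dots> \<le> 640 * eps t" by (rule nh(1))
  finally have "\<bar>\<alpha> - hex_centre p1 q1 p2 q2\<bar> * Q \<le> 320 * eps t" by (simp add: mult.commute)
  moreover have "\<bar>\<alpha> - hex_centre p1 q1 p2 q2\<bar> * (3 / 4 * s\<^sup>2) \<le> \<bar>\<alpha> - hex_centre p1 q1 p2 q2\<bar> * Q"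
    using Qs by (intro mult_left_mono) auto
  ultimately have close: "\<bar>\<alpha> - hex_centre p1 q1 p2 q2\<bar> * s\<^sup>2 \<le> 500 * eps t"
    using eps_bounds[OF t] by linarith
  \<comment> \<open>Swapping the basis vectors fixes the orientation and leaves the centre
    unchanged.\<close>
  consider "p1 * q2 - p2 * q1 = 1" | "p2 * q1 - p1 * q2 = 1" using det by linarith
  then show ?thesis
  proof cases
    case 1
    then show ?thesis using close s_t unfolding s_def by blast
  next
    case 2
    moreover have "max \<bar>q2\<bar> \<bar>q1\<bar> = max \<bar>q1\<bar> \<bar>q2\<bar>" by (rule max.commute)
    ultimately show ?thesis using close s_t unfolding s_def hex_centre_swap[of p1 q1 p2 q2, symmetric]
      by (metis hex_centre_swap)
  qed
qed

text \<open>At scale \<open>n\<close> there are of order \<open>4^n\<close> centres near the bounded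
  interval, each with an interval of length \<open>1000 * e n / 4^n\<close>. The total is of order
  \<open>e n\<close>, which is summable, and Borel-Cantelli applies.\<close>

lemma complement_D2_null_bounded:
  assumes conv: "summable (\<lambda>n. eps (max t0 (2 ^ n)))"
  shows "negligible ({- real M..real M} - D2 \<psi>)"
proof -
  have "\<forall>q1 q2. \<exists>\<beta>. 0 \<le> \<beta> \<and> \<beta> < 1 \<and> (\<forall>p1 p2. p1 * q2 - p2 * q1 = 1 \<longrightarrow>
      (\<exists>k :: int. hex_centre p1 q1 p2 q2 = \<beta> + real_of_int k))"
    by (intro allI hex_centre_mod_1)
  then obtain \<beta> where \<beta>': "\<forall>q1 q2. 0 \<le> \<beta> q1 q2 \<and> \<beta> q1 q2 < 1 \<and> (\<forall>p1 p2. p1 * q2 - p2 * q1 = 1 \<longrightarrow>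
      (\<exists>k :: int. hex_centre p1 q1 p2 q2 = \<beta> q1 q2 + real_of_int k))"
    unfolding choice_iff by (elim exE) (rule that)
  have \<beta>: "0 \<le> \<beta> q1 q2" "\<beta> q1 q2 < 1"
    "\<And>p1 p2. p1 * q2 - p2 * q1 = 1 \<Longrightarrow> \<exists>k :: int. hex_centre p1 q1 p2 q2 = \<beta> q1 q2 + real_of_int k" for q1 q2
    using \<beta>'[rule_format, of q1 q2] by blast+
  \<comment> \<open>The bounds \<open>2^n \<le> s\<close> and
    \<open>s^2 \<le> 20 t^2 \<le> (8 t)^2\<close> give \<open>t \<ge> 2^n / 8\<close>, hence
    \<open>eps t \<le> e n\<close>.\<close>
  define e where "e n = eps (max t0 (2 ^ n / 8))" for n :: nat
  have e0: "0 \<le> e n" for n using eps_bounds[of "max t0 (2 ^ n / 8)"] by (simp add: e_def)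
  have "summable (\<lambda>n. e (n + 3))" using conv by (simp add: e_def power_add)
  then have sume: "summable e" by (simp only: summable_iff_shift)
  \<comment> \<open>The centre lies within 1 of a point of \<open>[-M, M]\<close> and
    \<open>\<beta>\<close> lies in \<open>[0, 1)\<close>, so the integer translate satisfies
    \<open>|k| \<le> M + 2\<close>.\<close>
  define I where "I n = {- (2 ^ (n + 1)) .. 2 ^ (n + 1) :: int} \<times> {- (2 ^ (n + 1)) .. 2 ^ (n + 1) :: int} \<times> {- int M - 2 .. int M + 2}" for n :: nat
  define W where "W n = (\<Union>(q1, q2, k)\<in>I n. cball (\<beta> q1 q2 + real_of_int k) (500 * e n / 4 ^ n))" for n
  have Wm: "W n \<in> lmeasurable" for n
    unfolding W_def by (intro fmeasurable.finite_UN) (auto simp: I_def)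
  have cardI: "real (card (I n)) \<le> 64 * 4 ^ n * (2 * real M + 5)" for n
  proof -
    have "real (card (I n)) = (4 * 2 ^ n + 1)\<^sup>2 * (2 * real M + 5)"
      unfolding I_def by (simp add: card_cartesian_product power2_eq_square nat_add_distrib nat_mult_distrib nat_power_eq algebra_simps)
    also have "(4 * 2 ^ n + 1 :: real)\<^sup>2 \<le> (8 * 2 ^ n)\<^sup>2"
    proof (rule power_mono)
      have "(1 :: real) \<le> 2 ^ n" by simp
      then show "(4 * 2 ^ n + 1 :: real) \<le> 8 * 2 ^ n" by linarith
    qed simp
    also have "(8 * 2 ^ n :: real)\<^sup>2 = 64 * 4 ^ n" by (simp add: power2_eq_square power_mult_distrib[symmetric])
    finally show ?thesis by (simp add: mult_right_mono)
  qed
  have Wle: "measure lebesgue (W n) \<le> 64000 * (2 * real M + 5) * e n" for n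
  proof -
    have "measure lebesgue (W n) \<le> (\<Sum>i\<in>I n. measure lebesgue (case i of (q1, q2, k) \<Rightarrow> cball (\<beta> q1 q2 + real_of_int k) (500 * e n / 4 ^ n)))"
      unfolding W_def by (intro measure_UNION_le) (auto simp: I_def)
    also have "\<dots> = (\<Sum>i\<in>I n. 1000 * e n / 4 ^ n)"
      using e0[of n] by (intro sum.cong) (auto simp: cball_eq_atLeastAtMost)
    also have "\<dots> = real (card (I n)) * (1000 * e n / 4 ^ n)" by simp
    also have "\<dots> \<le> (64 * 4 ^ n * (2 * real M + 5)) * (1000 * e n / 4 ^ n)"
      using cardI e0 by (intro mult_right_mono) auto
    finally show ?thesis by (simp add: mult_ac)
  qed
  have "limsup W \<in> null_sets lebesgue"
  proof (rule borel_cantelli_limsup1)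
    show "W n \<in> sets lebesgue" "emeasure lebesgue (W n) < \<infinity>" for n
      using Wm[of n] by (auto simp: fmeasurable_def)
    show "summable (\<lambda>n. measure lebesgue (W n))"
      by (rule summable_comparison_test'[OF summable_mult[OF sume, of "64000 * (2 * real M + 5)"], of 0])
        (use Wle in auto)
  qed
  moreover have "{- real M..real M} - D2 \<psi> \<subseteq> limsup W"
  proof
    fix \<alpha> assume \<alpha>: "\<alpha> \<in> {- real M..real M} - D2 \<psi>"
    have "\<exists>n\<ge>N. \<alpha> \<in> W n" for N
    proof -
      have "e \<longlonglongrightarrow> 0" using sume by (rule summable_LIMSEQ_zero)
      then have "\<forall>\<^sub>F n in sequentially. e n < 1 / 2" by (intro order_tendstoD) auto
      then obtain n0 where n0: "e n0 < 1 / 2" by (auto simp: eventually_sequentially)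
      \<comment> \<open>The first bound makes \<open>eps t \<le> 1/2\<close>. The second, with
        \<open>t^2 \<le> 30 s^2 \<le> (6 s)^2\<close>, gives \<open>s \<ge> 2^(N + 12)\<close>; the
        12 extra levels also make the intervals of radius at most 1.\<close>
      define T where "T = max (max t0 (2 ^ n0 / 8)) (6 * 2 ^ (N + 12))"
      obtain t where t: "t \<ge> max t0 T" "sparse \<alpha> t" using \<alpha> notin_D2_iff[of \<alpha>] by auto
      have t0: "t \<ge> t0" and t0_pos: "t0 > 0" using t t0 by simp_all
      have "eps t \<le> e n0" unfolding e_def by (rule eps_antimono) (use t in \<open>auto simp: T_def\<close>)
      then have eps: "eps t \<le> 1 / 2" using n0 by simp
      obtain p1 q1 p2 q2 where det: "p1 * q2 - p2 * q1 = 1"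
        and close: "\<bar>\<alpha> - hex_centre p1 q1 p2 q2\<bar> * real_of_int (max \<bar>q1\<bar> \<bar>q2\<bar>) ^ 2 \<le> 500 * eps t"
        and st: "t\<^sup>2 \<le> 30 * real_of_int (max \<bar>q1\<bar> \<bar>q2\<bar>) ^ 2" "real_of_int (max \<bar>q1\<bar> \<bar>q2\<bar>) ^ 2 \<le> 20 * t\<^sup>2"
        using near_hex_centre[OF t0 eps t(2)] by blast
      define s where "s = nat (max \<bar>q1\<bar> \<bar>q2\<bar>)"
      have s: "real_of_int (max \<bar>q1\<bar> \<bar>q2\<bar>) = real s" "int s = max \<bar>q1\<bar> \<bar>q2\<bar>" by (auto simp: s_def)
      have tN: "6 * 2 ^ (N + 12) \<le> t" using t by (simp add: T_def)
      have sN: "2 ^ (N + 12) \<le> s"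
      proof -
        have "36 * (2 ^ (N + 12))\<^sup>2 \<le> t\<^sup>2"
          using power_mono[OF tN, of 2] by (simp add: power_mult_distrib)
        also have "\<dots> \<le> 36 * real s ^ 2" using st(1) zero_le_power2[of "real s"] unfolding s by linarith
        finally have "(2 ^ (N + 12))\<^sup>2 \<le> real s ^ 2" by simp
        then have "2 ^ (N + 12) \<le> real s" by (rule power2_le_imp_le) simp
        then show ?thesis by (metis of_nat_le_iff of_nat_numeral of_nat_power)
      qed
      have "1 \<le> s" using sN by (meson le_trans one_le_numeral one_le_power)
      then obtain n where n: "2 ^ n \<le> s" "s < 2 ^ (n + 1)" using ex_power_ivl1[of 2 s] by auto
      have "(2 :: nat) ^ (N + 12) < 2 ^ (n + 1)" using sN n(2) by linarith
      then have "N + 12 < n + 1" by (rule power_less_imp_less_exp[rotated]) simp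
      then have nN: "N + 12 \<le> n" by simp
      have rn: "2 ^ n \<le> real s" using n(1) by (metis of_nat_le_iff of_nat_numeral of_nat_power)
      have "(8 * t)\<^sup>2 = 64 * t\<^sup>2" by (simp add: power_mult_distrib)
      then have "real s ^ 2 \<le> (8 * t)\<^sup>2" using st(2) zero_le_power2[of t] unfolding s by linarith
      then have "real s \<le> 8 * t" by (rule power2_le_imp_le) (use t0_pos t0 in simp)
      then have "max t0 (2 ^ n / 8) \<le> t" using rn t0 by linarith
      then have "eps t \<le> e n" unfolding e_def by (intro eps_antimono) auto
      have "(2 ^ n)\<^sup>2 \<le> real s ^ 2" using rn by (intro power_mono) auto
      then have "4 ^ n \<le> real s ^ 2" by (simp add: power2_eq_square power_mult_distrib[symmetric])
      then have "\<bar>\<alpha> - hex_centre p1 q1 p2 q2\<bar> * 4 ^ n \<le> \<bar>\<alpha> - hex_centre p1 q1 p2 q2\<bar> * real s ^ 2"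
        by (intro mult_left_mono) auto
      also have "\<dots> \<le> 500 * eps t" using close unfolding s .
      also have "\<dots> \<le> 500 * e n" using \<open>eps t \<le> e n\<close> by simp
      finally have c: "\<bar>\<alpha> - hex_centre p1 q1 p2 q2\<bar> \<le> 500 * e n / 4 ^ n" by (simp add: field_simps)
      have "500 * e n / 4 ^ n \<le> 1"
      proof -
        have "e n \<le> 1" using eps_bounds[of "max t0 (2 ^ n / 8)"] by (simp add: e_def)
        moreover have "(4 :: real) ^ 12 \<le> 4 ^ n" using nN by (intro power_increasing) auto
        ultimately show ?thesis by simp
      qed
      with c have c1: "\<bar>\<alpha> - hex_centre p1 q1 p2 q2\<bar> \<le> 1" by linarith
      obtain k where k: "hex_centre p1 q1 p2 q2 = \<beta> q1 q2 + real_of_int k" using \<beta>(3)[OF det] by blast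
      have "\<bar>real_of_int k\<bar> \<le> real M + 2" using c1 k \<beta>(1,2)[of q1 q2] \<alpha> by (auto simp: abs_le_iff)
      then have "k \<in> {- int M - 2..int M + 2}" by auto
      moreover have "int s \<le> 2 ^ (n + 1)" using n(2) by (metis less_imp_le of_nat_le_iff of_nat_numeral of_nat_power)
      then have "q1 \<in> {- (2 ^ (n + 1))..2 ^ (n + 1)}" "q2 \<in> {- (2 ^ (n + 1))..2 ^ (n + 1)}"
        unfolding s(2) by (auto simp: abs_le_iff)
      ultimately have "(q1, q2, k) \<in> I n" by (simp add: I_def)
      moreover have "\<alpha> \<in> cball (\<beta> q1 q2 + real_of_int k) (500 * e n / 4 ^ n)"
        using c unfolding k by (simp add: dist_real_def abs_minus_commute)
      ultimately have "\<alpha> \<in> W n" unfolding W_def by blast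
      then show ?thesis using nN by (intro exI[of _ n]) simp
    qed
    then show "\<alpha> \<in> limsup W" by (auto simp: limsup_INF_SUP)
  qed
  ultimately show ?thesis
    by (meson negligible_iff_null_sets negligible_subset)
qed

lemma complement_D2_negligible:
  assumes conv: "summable (\<lambda>n. eps (max t0 (2 ^ n)))"
  shows "negligible (UNIV - D2 \<psi>)"
proof -
  have "negligible (\<Union>M. {- real M..real M} - D2 \<psi>)"
    using complement_D2_null_bounded[OF conv] by (intro negligible_countable_Union) auto
  moreover have "UNIV - D2 \<psi> \<subseteq> (\<Union>M. {- real M..real M} - D2 \<psi>)"
  proof
    fix \<alpha> assume "\<alpha> \<in> UNIV - D2 \<psi>"
    moreover obtain M :: nat where "\<bar>\<alpha>\<bar> \<le> real M" using real_arch_simple by blast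
    ultimately show "\<alpha> \<in> (\<Union>M. {- real M..real M} - D2 \<psi>)" by (auto simp: abs_le_iff intro!: exI[of _ M])
  qed
  ultimately show ?thesis by (rule negligible_subset)
qed

end

text \<open>As \<open>\<psi>\<close> is constrained only from \<open>t0\<close> on, the sums start
  at the first integer not below \<open>t0\<close>. Their terms are positive there, so divergence of
  the series means that the partial sums tend to infinity.\<close>

theorem theorem1p6:
  fixes \<psi> :: "real \<Rightarrow> real" and t0 :: real
  assumes "t0 > 0"
    and "\<And>t. t \<ge> t0 \<Longrightarrow> \<psi> t > 0"
    and "continuous_on {t0..} \<psi>"
    and "antimono_on {t0..} \<psi>"
    and "\<forall>\<^sub>F t in at_top. \<psi> t < 1 / t"
    and "mono_on {t0..} (\<lambda>t. t * \<psi> t)"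
  shows "(filterlim (\<lambda>n. \<Sum>k = nat \<lceil>t0\<rceil>..n. 1 / real k - \<psi> (real k)) at_top sequentially
            \<longrightarrow> D2 \<psi> \<in> null_sets lebesgue) \<and>
         (convergent (\<lambda>n. \<Sum>k = nat \<lceil>t0\<rceil>..n. 1 / real k - \<psi> (real k))
            \<longrightarrow> UNIV - D2 \<psi> \<in> null_sets lebesgue)"
proof -
  interpret approx_function \<psi> t0
    using assms by unfold_locales auto
  have "\<not> convergent (\<lambda>n. \<Sum>k = nat \<lceil>t0\<rceil>..n. 1 / real k - \<psi> (real k))"
    if "filterlim (\<lambda>n. \<Sum>k = nat \<lceil>t0\<rceil>..n. 1 / real k - \<psi> (real k)) at_top sequentially"
    using not_tendsto_and_filterlim_at_infinity[OF _ _ filterlim_at_top_imp_at_infinity[OF that]]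
    by (auto simp: convergent_def)
  then show ?thesis
    using D2_negligible complement_D2_negligible summable_eps_iff by (simp add: negligible_iff_null_sets)
qed

end
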